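(* Let $\mathcal C$ be a substitution-closed class of permutations with $12,21\in\mathcal C$, let $\mathcal S$ be the set of simple permutations in $\mathcal C$, and let $\mathcal P$ be the class of (finite) $\mathcal S$-packed trees. The function $$\mathrm{DF}:\mathcal C\to \mathrm{Seq}_{\ge1}(\mathcal P)$$ is a size-preserving bijection between $\mathcal C$ and the collection $\mathrm{Seq}_{\ge1}(\mathcal P)$ of non-empty finite ordered sequences (forests) of $\mathcal S$-packed trees, the size of a forest being its total number of leaves.
   Context: Permutations. A permutation class is a set of permutations closed under taking patterns. For $\theta$ of size $d$, the substitution $\theta[\nu^{(1)},\dots,\nu^{(d)}]$ is obtained by replacing each $\theta(i)$ by a sequence of integers (forming an interval of values) order-isomorphic to $\nu^{(i)}$, keeping the relative order induced by $\theta$ between these subsequences. $\mathcal C$ is substitution-closed if $\theta,\nu^{(1)},\dots,\nu^{(d)}\in\mathcal C$ implies $\theta[\nu^{(1)},\dots,\nu^{(d)}]\in\mathcal C$. A permutation of size $n>2$ is simple if it maps no interval of $[n]$ with at least $2$ and at most $n-1$ elements onto an interval. For $k\ge2$, $\oplus_k=12\cdots k$ and $\ominus_k=k\cdots21$; the index is dropped when clear (in $\oplus[\nu^{(1)},\dots,\nu^{(d)}]$ it is $d$). $\nu$ is $\oplus$-indecomposable (resp. $\ominus$-indecomposable) if it cannot be written $\oplus[\nu^{(1)},\nu^{(2)}]$ (resp. $\ominus[\nu^{(1)},\nu^{(2)}]$). By a theorem of Albert and Atkinson, every permutation of size $\ge2$ can be written uniquely in exactly one of the forms: $\alpha[\nu^{(1)},\dots,\nu^{(d)}]$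 with $\alpha$ simple of size $d$; $\oplus[\nu^{(1)},\dots,\nu^{(d)}]$ with $d\ge2$ and all $\nu^{(i)}$ $\oplus$-indecomposable; $\ominus[\nu^{(1)},\dots,\nu^{(d)}]$ with $d\ge2$ and all $\nu^{(i)}$ $\ominus$-indecomposable. Trees. Trees are rooted plane trees; the outdegree of a vertex is its number of children; leaves have outdegree $0$; other vertices are internal. For a set $\mathcal D$ of objects with sizes, a $\mathcal D$-decorated tree is a plane tree with each internal vertex $v$ carrying a decoration in $\mathcal D$ whose size equals the outdegree of $v$. Canonical trees. The canonical tree $\mathrm{CT}(\nu)$ is defined recursively: a single leaf if $|\nu|=1$; otherwise, if $\nu=\beta[\nu^{(1)},\dots,\nu^{(d)}]$ is the unique decomposition of $\nu$ (given by the theorem of Albert and Atkinson) in which either $\beta$ is simple of size $d$, or $\beta=\oplus_d$ with $d\ge2$ and all $\nu^{(i)}$ $\oplus$-indecomposable, or $\beta=\ominus_d$ with $d\ge2$ and all $\nu^{(i)}$ $\ominus$-indecomposable, its root is decorated by $\beta$ and the subtrees attached to the root are $\mathrm{CT}(\nu^{(1)}),\dots,\mathrm{CT}(\nu^{(d)})$ from left to right. Packed trees. An $\mathcal S$-gadget is a tree of height at most $2$, whose internal vertices are decorated by permutations of size equal to their outdegree, such that the root is internal and decorated by a permutation in $\mathcal S$, and each child of the root is either a leaf or decorated by an increasing permutation $\oplus_k$, $k\ge2$. Its size is its number of leaves. Let $\mathcal G(\mathcal S)$ be the set of $\mathcal S$-gadgets and $\widehat{\mathcal G(\mathcal S)}=\mathcal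 G(\mathcal S)\cup\{\circledast_k:k\ge2\}$, where $\circledast_k$ is an object of size $k$. An $\mathcal S$-packed tree is a finite $\widehat{\mathcal G(\mathcal S)}$-decorated tree; its size is its number of leaves (the single-leaf tree is included). Packing map. If $T$ is the canonical tree of a permutation of $\mathcal C$ and its root is not decorated by $\oplus$, $\mathrm{PA}(T)$ is obtained as follows. For each internal vertex $v$ of $T$ decorated by a simple permutation, let $G_v$ be the $\mathcal S$-gadget whose internal vertices are $v$ and the $\oplus$-decorated children of $v$, with relations, order and decorations inherited from $T$, and with leaves added so that outdegrees of internal vertices are the same in $G_v$ as in $T$; merge $v$ and its $\oplus$-decorated children into a single vertex decorated by $G_v$. All remaining internal vertices, decorated by $\oplus_k$ or $\ominus_k$, get decoration $\circledast_k$ instead. The map $\mathrm{DF}$. Every $\nu\in\mathcal C$ is uniquely either $\oplus$-indecomposable (set $d=1$, $\nu^{(1)}=\nu$) or of the form $\oplus[\nu^{(1)},\dots,\nu^{(d)}]$ with $d\ge2$ and all $\nu^{(i)}$ $\oplus$-indecomposable; $\mathrm{DF}(\nu)=(\mathrm{PA}(\mathrm{CT}(\nu^{(1)})),\dots,\mathrm{PA}(\mathrm{CT}(\nu^{(d)})))$. *)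

theory Defs
  imports "HOL-Library.Sublist"
begin

section \<open>Permutations\<close>

text \<open>A permutation of size \<open>n \<ge> 1\<close> is its one-line notation: a list of length \<open>n\<close> enumerating
  \<open>{1..n}\<close>. List positions count from \<open>0\<close>, values from \<open>1\<close>.\<close>

type_synonym perm = "nat list"

definition is_perm :: "perm \<Rightarrow> bool" where
  "is_perm \<nu> \<longleftrightarrow> \<nu> \<noteq> [] \<and> distinct \<nu> \<and> set \<nu> = {1..length \<nu>}"

definition order_iso :: "nat list \<Rightarrow> nat list \<Rightarrow> bool" where
  "order_iso xs ys \<longleftrightarrow> length xs = length ys \<and>
     (\<forall>i<length xs. \<forall>j<length xs. xs ! i < xs ! j \<longleftrightarrow> ys ! i < ys ! j)"

definition is_pattern_of :: "perm \<Rightarrow> perm \<Rightarrow> bool" where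
  "is_pattern_of \<pi> \<nu> \<longleftrightarrow> is_perm \<pi> \<and> (\<exists>xs. subseq xs \<nu> \<and> order_iso \<pi> xs)"

definition permutation_class :: "perm set \<Rightarrow> bool" where
  "permutation_class C \<longleftrightarrow> (\<forall>\<nu>\<in>C. is_perm \<nu>) \<and> (\<forall>\<nu>\<in>C. \<forall>\<pi>. is_pattern_of \<pi> \<nu> \<longrightarrow> \<pi> \<in> C)"

text \<open>In \<open>\<theta>[\<nu>\<^sub>1,\<dots>,\<nu>\<^sub>d]\<close> the block replacing the \<open>i\<close>-th entry of \<open>\<theta>\<close> is \<open>\<nu>\<^sub>i\<close>, shifted above
  the total size of the blocks whose entry in \<open>\<theta>\<close> is smaller. Used only when
  \<open>length \<nu>s = length \<theta>\<close>.\<close>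

definition inflate :: "perm \<Rightarrow> perm list \<Rightarrow> perm" where
  "inflate \<theta> \<nu>s = concat (map (\<lambda>i. map (\<lambda>x. x + (\<Sum>j | j < length \<theta> \<and> \<theta> ! j < \<theta> ! i. length (\<nu>s ! j))) (\<nu>s ! i))
      [0..<length \<theta>])"

definition substitution_closed :: "perm set \<Rightarrow> bool" where
  "substitution_closed C \<longleftrightarrow>
     (\<forall>\<theta>\<in>C. \<forall>\<nu>s. length \<nu>s = length \<theta> \<and> set \<nu>s \<subseteq> C \<longrightarrow> inflate \<theta> \<nu>s \<in> C)"

text \<open>Below, \<open>{i..j}\<close> runs through the intervals of positions with at least \<open>2\<close> and at most
  \<open>n - 1\<close> elements.\<close>

definition simple_perm :: "perm \<Rightarrow> bool" where
  "simple_perm \<sigma> \<longleftrightarrow> is_perm \<sigma> \<and> 2 < length \<sigma> \<and>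
     (\<forall>i j. i < j \<and> j < length \<sigma> \<and> card {i..j} \<le> length \<sigma> - 1 \<longrightarrow>
        \<not> (\<exists>a b. (\<lambda>k. \<sigma> ! k) ` {i..j} = {a..b}))"

definition oplus :: "nat \<Rightarrow> perm" where
  "oplus k = [1..<k + 1]"

definition ominus :: "nat \<Rightarrow> perm" where
  "ominus k = rev [1..<k + 1]"

definition oplus_indecomposable :: "perm \<Rightarrow> bool" where
  "oplus_indecomposable \<nu> \<longleftrightarrow>
     \<not> (\<exists>\<nu>1 \<nu>2. is_perm \<nu>1 \<and> is_perm \<nu>2 \<and> \<nu> = inflate (oplus 2) [\<nu>1, \<nu>2])"

definition ominus_indecomposable :: "perm \<Rightarrow> bool" where
  "ominus_indecomposable \<nu> \<longleftrightarrow>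
     \<not> (\<exists>\<nu>1 \<nu>2. is_perm \<nu>1 \<and> is_perm \<nu>2 \<and> \<nu> = inflate (ominus 2) [\<nu>1, \<nu>2])"

section \<open>Decorated plane trees\<close>

datatype 'a ptree = Leaf | Node 'a "'a ptree list"

fun leaves :: "'a ptree \<Rightarrow> nat" where
  "leaves Leaf = 1"
| "leaves (Node a ts) = sum_list (map leaves ts)"

fun height :: "'a ptree \<Rightarrow> nat" where
  "height Leaf = 0"
| "height (Node a ts) = Suc (Max (insert 0 (height ` set ts)))"

fun decorated_tree :: "'a set \<Rightarrow> ('a \<Rightarrow> nat) \<Rightarrow> 'a ptree \<Rightarrow> bool" where
  "decorated_tree D sz Leaf \<longleftrightarrow> True"
| "decorated_tree D sz (Node a ts) \<longleftrightarrow>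
     a \<in> D \<and> sz a = length ts \<and> (\<forall>t\<in>set ts. decorated_tree D sz t)"

section \<open>Canonical trees\<close>

definition canonical_decomposition :: "perm \<Rightarrow> perm \<Rightarrow> perm list \<Rightarrow> bool" where
  "canonical_decomposition \<nu> \<beta> \<nu>s \<longleftrightarrow>
     length \<nu>s = length \<beta> \<and> (\<forall>\<mu>\<in>set \<nu>s. is_perm \<mu>) \<and> \<nu> = inflate \<beta> \<nu>s \<and>
     (simple_perm \<beta>
      \<or> (\<exists>d\<ge>2. \<beta> = oplus d \<and> (\<forall>\<mu>\<in>set \<nu>s. oplus_indecomposable \<mu>))
      \<or> (\<exists>d\<ge>2. \<beta> = ominus d \<and> (\<forall>\<mu>\<in>set \<nu>s. ominus_indecomposable \<mu>)))"

text \<open>The recursive definition of the canonical tree is given as an inductive relation, because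
  a recursive function would need the Albert--Atkinson theorem for its termination. The
  same theorem makes the relation functional on permutations, so that \<open>CT\<close> is well defined.\<close>

inductive canonical_tree :: "perm \<Rightarrow> perm ptree \<Rightarrow> bool" where
  Leaf: "is_perm \<nu> \<Longrightarrow> length \<nu> = 1 \<Longrightarrow> canonical_tree \<nu> Leaf"
| Node: "canonical_decomposition \<nu> \<beta> \<nu>s \<Longrightarrow> list_all2 canonical_tree \<nu>s ts \<Longrightarrow>
     canonical_tree \<nu> (Node \<beta> ts)"

definition CT :: "perm \<Rightarrow> perm ptree" where
  "CT \<nu> = (THE T. canonical_tree \<nu> T)"

section \<open>Packed trees\<close>

definition is_gadget :: "perm set \<Rightarrow> perm ptree \<Rightarrow> bool" where
  "is_gadget S g \<longleftrightarrow> height g \<le> 2 \<and> decorated_tree {\<nu>. is_perm \<nu>} length g \<and>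
     (\<exists>\<alpha> ts. g = Node \<alpha> ts \<and> \<alpha> \<in> S \<and>
        (\<forall>t\<in>set ts. t = Leaf \<or> (\<exists>k us. k \<ge> 2 \<and> t = Node (oplus k) us)))"

text \<open>\<open>Star k\<close> is the object \<open>\<circledast>\<^sub>k\<close> of size \<open>k\<close>.\<close>

datatype decoration = Gadget "perm ptree" | Star nat

fun decoration_size :: "decoration \<Rightarrow> nat" where
  "decoration_size (Gadget g) = leaves g"
| "decoration_size (Star k) = k"

definition packed_decorations :: "perm set \<Rightarrow> decoration set" where
  "packed_decorations S = {Gadget g | g. is_gadget S g} \<union> {Star k | k. k \<ge> 2}"

definition packed_trees :: "perm set \<Rightarrow> decoration ptree set" where
  "packed_trees S = {P. decorated_tree (packed_decorations S) decoration_size P}"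

section \<open>The packing map\<close>

fun oplus_rooted :: "perm ptree \<Rightarrow> bool" where
  "oplus_rooted Leaf \<longleftrightarrow> False"
| "oplus_rooted (Node \<beta> ts) \<longleftrightarrow> (\<exists>k\<ge>2. \<beta> = oplus k)"

text \<open>For a child \<open>t\<close> of a vertex \<open>v\<close> with simple decoration, \<open>gadget_part t\<close> is what remains of \<open>t\<close>
  in the gadget of \<open>v\<close>, and \<open>attached t\<close> lists the subtrees that \<open>t\<close> contributes below
  the merged vertex.\<close>

fun gadget_part :: "perm ptree \<Rightarrow> perm ptree" where
  "gadget_part Leaf = Leaf"
| "gadget_part (Node \<beta> ts) =
     (if oplus_rooted (Node \<beta> ts) then Node \<beta> (map (\<lambda>_. Leaf) ts) else Leaf)"

fun attached :: "perm ptree \<Rightarrow> perm ptree list" where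
  "attached Leaf = [Leaf]"
| "attached (Node \<beta> ts) = (if oplus_rooted (Node \<beta> ts) then ts else [Node \<beta> ts])"

lemma size_less_size_list: "(t :: 'a ptree) \<in> set ts \<Longrightarrow> size t < Suc (size_list size ts)"
  using size_list_estimation'[of t ts "size t" size] by simp

lemma size_attached: "u \<in> set (attached t) \<Longrightarrow> size u \<le> size t"
  by (cases t) (auto split: if_splits dest: size_less_size_list)

lemma size_attached_list:
  assumes "t \<in> set ts" and "u \<in> set (attached t)"
  shows "size u < Suc (size_list size ts)"
  using size_attached[OF assms(2)] size_less_size_list[OF assms(1)] by simp

text \<open>Only trees whose root is not decorated by some \<open>\<oplus>\<^sub>k\<close> are in the intended domain of \<open>PA\<close>.\<close>

function PA :: "perm ptree \<Rightarrow> decoration ptree" where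
  "PA Leaf = Leaf"
| "PA (Node \<beta> ts) =
     (if simple_perm \<beta>
      then Node (Gadget (Node \<beta> (map gadget_part ts))) (map PA (concat (map attached ts)))
      else Node (Star (length \<beta>)) (map PA ts))"
  by pat_completeness auto
termination
  by (relation "measure size")
     (auto dest: size_attached_list size_less_size_list simp flip: less_Suc_eq_le)

section \<open>The map DF\<close>

definition oplus_components :: "perm \<Rightarrow> perm list" where
  "oplus_components \<nu> = (THE \<nu>s.
     (oplus_indecomposable \<nu> \<and> \<nu>s = [\<nu>])
     \<or> (\<exists>d\<ge>2. length \<nu>s = d \<and> (\<forall>\<mu>\<in>set \<nu>s. is_perm \<mu> \<and> oplus_indecomposable \<mu>) \<and>
          \<nu> = inflate (oplus d) \<nu>s))"

definition DF :: "perm \<Rightarrow> decoration ptree list" where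
  "DF \<nu> = map (\<lambda>\<mu>. PA (CT \<mu>)) (oplus_components \<nu>)"

definition Seq1 :: "'a set \<Rightarrow> 'a list set" where
  "Seq1 A = {xs. xs \<noteq> [] \<and> set xs \<subseteq> A}"

definition forest_size :: "'a ptree list \<Rightarrow> nat" where
  "forest_size F = sum_list (map leaves F)"

end

theory Submission
  imports Defs
begin

text \<open>Call a list of lists a block decomposition of a permutation \<open>\<nu>\<close> if its concatenation is \<open>\<nu>\<close> and of
  any two blocks one lies entirely below the other; inflations \<open>\<beta>[\<nu>\<^sub>1,\<dots>,\<nu>\<^sub>d] = \<nu>\<close> correspond to block
  decompositions by standardising the blocks and the list of their first entries. A decomposition with
  the least number \<open>\<ge> 2\<close> of blocks has a simple quotient unless \<open>\<nu>\<close> is a sum or a skew sum, and in the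
  presence of a simple quotient every proper interval of \<open>\<nu>\<close> lies inside one block, so that two such
  decompositions refine each other. This yields the Albert--Atkinson theorem and makes \<open>CT\<close> a bijection
  with inverse given by iterated inflation.

  Packing forgets whether a vertex was \<open>\<oplus>\<close> or \<open>\<ominus>\<close>, but this can be recovered from the root down:
  a \<open>\<circledast>\<close> at the root or below a gadget comes from \<open>\<ominus>\<close>, since the \<open>\<oplus>\<close>-children of a simple vertex are
  absorbed in its gadget, and a \<open>\<circledast>\<close> below a \<open>\<circledast>\<close> has the opposite sign.\<close>

section \<open>Standardisation and block decompositions\<close>

text \<open>The blocks keep their actual values, so that two decompositions of a permutation are
  lists with a common concatenation and uniqueness needs no arithmetic with shifts. Sums and skew
  sums are treated together through a relation \<open>R\<close> that is \<open>(<)\<close> or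
  \<open>(>)\<close>.

  The hypotheses on the class act in opposite directions: closure under patterns puts the parts of a
  decomposition back into the class, while closure under substitution, with 12 and 21, makes every
  tree with simple decorations from the class and no sign repeated along an edge the canonical tree
  of a permutation in the class.

  The obstacle in packing is that the sign of a \<circledast> depends on what lies above it, so a
  statement about one kind of root does not pass to subtrees. Injectivity is therefore proved for
  two trees whose roots avoid a common sign, and surjectivity provides, for each sign, a preimage
  whose root avoids it.\<close>

definition std :: "nat list \<Rightarrow> perm" where
  "std xs = map (\<lambda>x. card {y \<in> set xs. y \<le> x}) xs"

lemma length_std [simp]: "length (std xs) = length xs"
  by (simp add: std_def)

lemma std_eq_Nil_iff [simp]: "std xs = [] \<longleftrightarrow> xs = []"
  by (simp add: std_def)

lemma strict_mono_on_rank: "strict_mono_on (set xs) (\<lambda>x. card {y \<in> set xs. y \<le> (x::nat)})"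
proof (intro strict_mono_onI psubset_card_mono)
  fix r s assume "r \<in> set xs" "s \<in> set xs" "r < s"
  then have "s \<in> {y \<in> set xs. y \<le> s} - {y \<in> set xs. y \<le> r}" by simp
  then show "{y \<in> set xs. y \<le> r} \<subset> {y \<in> set xs. y \<le> s}" using \<open>r < s\<close> by force
qed simp

lemma std_eq_map: "\<exists>f. strict_mono_on (set xs) f \<and> std xs = map f xs"
  using strict_mono_on_rank std_def by metis

lemma is_perm_std:
  assumes "xs \<noteq> []" "distinct xs"
  shows "is_perm (std xs)"
proof -
  have d: "distinct (std xs)"
    unfolding std_def using assms strict_mono_on_imp_inj_on[OF strict_mono_on_rank, of xs]
    by (simp add: distinct_map)
  have "set (std xs) \<subseteq> {1..length xs}"
  proof
    fix v assume "v \<in> set (std xs)"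
    then obtain x where x: "x \<in> set xs" "v = card {y \<in> set xs. y \<le> x}" by (auto simp: std_def)
    have "0 < v" unfolding x(2) using x(1) by (subst card_gt_0_iff) auto
    moreover have "v \<le> card (set xs)" unfolding x(2) by (intro card_mono) auto
    ultimately show "v \<in> {1..length xs}" using card_length[of xs] by auto
  qed
  moreover have "card (set (std xs)) = length xs"
    using distinct_card[OF d] by simp
  ultimately have "set (std xs) = {1..length xs}" by (intro card_subset_eq) auto
  with d assms show ?thesis by (simp add: is_perm_def)
qed

lemma std_perm:
  assumes "is_perm \<nu>"
  shows "std \<nu> = \<nu>"
proof -
  have "card {y \<in> set \<nu>. y \<le> x} = x" if "x \<in> set \<nu>" for x
  proof -
    have "{y \<in> set \<nu>. y \<le> x} = {1..x}" using assms that by (auto simp: is_perm_def)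
    then show ?thesis by simp
  qed
  then show ?thesis by (simp add: std_def map_idI)
qed

text \<open>Ranks are counted by positions instead of values, because \<open>order_iso\<close>
  compares two lists position by position; distinctness makes the two counts agree.\<close>

lemma nth_std:
  assumes "distinct xs" "i < length xs"
  shows "std xs ! i = card {j. j < length xs \<and> xs ! j \<le> xs ! i}"
proof -
  have "{y \<in> set xs. y \<le> xs ! i} = (!) xs ` {j. j < length xs \<and> xs ! j \<le> xs ! i}"
    by (auto simp: in_set_conv_nth)
  moreover have "inj_on ((!) xs) {j. j < length xs \<and> xs ! j \<le> xs ! i}"
    using assms by (auto simp: inj_on_def nth_eq_iff_index_eq)
  ultimately show ?thesis using assms by (simp add: std_def card_image)
qed

lemma order_iso_std:  "order_iso (std xs) xs"
proof -
  obtain f where "strict_mono_on (set xs) f" "std xs = map f xs" using std_eq_map by blast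
  then show ?thesis by (auto simp: order_iso_def strict_mono_on_less)
qed

lemma std_cong:
  assumes "distinct xs" "order_iso xs ys"
  shows "std xs = std ys"
proof (rule nth_equalityI)
  have l: "length ys = length xs" and
    o: "\<And>i j. i < length xs \<Longrightarrow> j < length xs \<Longrightarrow> xs ! i < xs ! j \<longleftrightarrow> ys ! i < ys ! j"
    using assms(2) by (auto simp: order_iso_def)
  have "distinct ys"
    unfolding distinct_conv_nth
  proof (intro allI impI)
    fix i j assume ij: "i < length ys" "j < length ys" "i \<noteq> j"
    then have "xs ! i < xs ! j \<or> xs ! j < xs ! i"
      using assms(1) l by (auto simp: distinct_conv_nth neq_iff)
    then show "ys ! i \<noteq> ys ! j" using o ij l by (metis less_irrefl)
  qed
  fix i assume i: "i < length (std xs)"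
  have "{j. j < length xs \<and> xs ! j \<le> xs ! i} = {j. j < length ys \<and> ys ! j \<le> ys ! i}"
    using o i l by (auto simp: not_less[symmetric])
  then show "std xs ! i = std ys ! i"
    using i l \<open>distinct ys\<close> assms(1) by (simp add: nth_std)
qed (use assms in \<open>auto simp: order_iso_def\<close>)

definition below :: "nat list \<Rightarrow> nat list \<Rightarrow> bool" (infix "\<lless>" 50) where
  "xs \<lless> ys \<longleftrightarrow> (\<forall>x\<in>set xs. \<forall>y\<in>set ys. x < y)"

text \<open>Comparable blocks are automatically disjoint, so distinctness is imposed only inside a
  block. Nonemptiness matters twice: \<open>hd\<close> has to represent a block, and an empty block
  would lie below and above everything at once.\<close>

definition blocks :: "nat list list \<Rightarrow> bool" where
  "blocks bs \<longleftrightarrow> (\<forall>b\<in>set bs. b \<noteq> [] \<and> distinct b) \<and> sorted_wrt (\<lambda>a b. a \<lless> b \<or> b \<lless> a) bs"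

lemma blocks_append:
  "blocks (as @ bs) \<longleftrightarrow> blocks as \<and> blocks bs \<and> (\<forall>a\<in>set as. \<forall>b\<in>set bs. a \<lless> b \<or> b \<lless> a)"
  by (auto simp: blocks_def sorted_wrt_append)

lemma blocks_Cons:
  "blocks (a # bs) \<longleftrightarrow> a \<noteq> [] \<and> distinct a \<and> blocks bs \<and> (\<forall>b\<in>set bs. a \<lless> b \<or> b \<lless> a)"
  by (auto simp: blocks_def)

lemma blocks_Nil [simp]: "blocks []"
  by (simp add: blocks_def)

lemma below_disjoint: "a \<lless> b \<or> b \<lless> a \<Longrightarrow> set a \<inter> set b = {}"
  by (fastforce simp: below_def)

lemma blocks_distinct_concat: "blocks bs \<Longrightarrow> distinct (concat bs)"
proof (induction bs)
  case (Cons a bs)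
  have "set a \<inter> set (concat bs) = {}"
    using Cons.prems below_disjoint[of a] by (fastforce simp: blocks_Cons)
  with Cons show ?case by (simp add: blocks_Cons)
qed simp

lemma blocks_nth:
  assumes "blocks bs" "i < length bs" "j < length bs" "i \<noteq> j"
  shows "bs ! i \<lless> bs ! j \<or> bs ! j \<lless> bs ! i"
  using assms unfolding blocks_def sorted_wrt_iff_nth_less by (metis nat_neq_iff)

lemma below_iff:
  assumes "a \<lless> b \<or> b \<lless> a" "x \<in> set a" "y \<in> set b"
  shows "a \<lless> b \<longleftrightarrow> x < y"
  using assms unfolding below_def by (meson less_asym)

text \<open>The rank of a value in the concatenation is its rank inside its own block plus the total
  size of the blocks lying below, and these are the blocks with a smaller head. This sum is exactly
  the shift in \<open>inflate\<close>.\<close>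

lemma inflate_std:
  assumes b: "blocks bs"
  shows "inflate (std (map hd bs)) (map std bs) = std (concat bs)"
proof -
  have ne: "bs ! i \<noteq> []" "distinct (bs ! i)" if "i < length bs" for i
    using b that by (auto simp: blocks_def)
  have lt: "bs ! i \<lless> bs ! j \<longleftrightarrow> x < y"
    if "i < length bs" "j < length bs" "i \<noteq> j" "x \<in> set (bs ! i)" "y \<in> set (bs ! j)" for i j x y
    using below_iff[OF blocks_nth[OF b that(1-3)] that(4,5)] .
  have hd: "std (map hd bs) ! j < std (map hd bs) ! i \<longleftrightarrow> hd (bs ! j) < hd (bs ! i)"
    if "i < length bs" "j < length bs" for i j
    using order_iso_std[of "map hd bs"] that by (simp add: order_iso_def)
  have rank: "card {y \<in> set (concat bs). y \<le> x} = card {y \<in> set (bs ! i). y \<le> x} +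
      (\<Sum>j | j < length bs \<and> hd (bs ! j) < hd (bs ! i). length (bs ! j))"
    if i: "i < length bs" and x: "x \<in> set (bs ! i)" for i x
  proof -
    let ?J = "{j. j < length bs \<and> hd (bs ! j) < hd (bs ! i)}"
    \<comment> \<open>Any element of block \<open>j\<close> can stand in for its head, and
      \<open>x\<close> for the head of block \<open>i\<close>, since comparable blocks compare in
      the same way at all their elements.\<close>
    have J: "j \<in> ?J \<longleftrightarrow> y < x" if "j < length bs" "j \<noteq> i" "y \<in> set (bs ! j)" for j y
      using lt[OF that(1) i that(2) that(3) x] lt[OF that(1) i that(2), of "hd (bs ! j)" "hd (bs ! i)"]
        ne i that by auto
    have iJ: "i \<notin> ?J" by simp
    have "{y \<in> set (concat bs). y \<le> x} = {y \<in> set (bs ! i). y \<le> x} \<union> (\<Union>j\<in>?J. set (bs ! j))"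
    proof (intro equalityI subsetI)
      fix y assume "y \<in> {y \<in> set (concat bs). y \<le> x}"
      then obtain j where j: "j < length bs" "y \<in> set (bs ! j)" "y \<le> x"
        by (auto simp: in_set_conv_nth[of _ bs])
      show "y \<in> {y \<in> set (bs ! i). y \<le> x} \<union> (\<Union>j\<in>?J. set (bs ! j))"
      proof (cases "j = i")
        case False
        have "y \<noteq> x" using below_disjoint[OF blocks_nth[OF b j(1) i False]] j x by auto
        then have "j \<in> ?J" using J[OF j(1) False j(2)] j by linarith
        with j show ?thesis by blast
      qed (use j in auto)
    next
      fix y assume "y \<in> {y \<in> set (bs ! i). y \<le> x} \<union> (\<Union>j\<in>?J. set (bs ! j))"
      then consider "y \<in> set (bs ! i)" "y \<le> x" | j where "j \<in> ?J" "y \<in> set (bs ! j)" by blast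
      then show "y \<in> {y \<in> set (concat bs). y \<le> x}"
      proof cases
        case 1
        then show ?thesis using i by auto
      next
        case 2
        then have "y < x" using J[of j y] iJ by (metis (lifting) mem_Collect_eq)
        then show ?thesis using 2 by auto
      qed
    qed
    moreover have "card (\<dots>) = card {y \<in> set (bs ! i). y \<le> x} + card (\<Union>j\<in>?J. set (bs ! j))"
    proof (rule card_Un_disjoint)
      show "{y \<in> set (bs ! i). y \<le> x} \<inter> (\<Union>j\<in>?J. set (bs ! j)) = {}"
        using below_disjoint[OF blocks_nth[OF b _ i]] iJ by (auto 4 4)
    qed auto
    moreover have "card (\<Union>j\<in>?J. set (bs ! j)) = (\<Sum>j\<in>?J. card (set (bs ! j)))"
    proof (rule card_UN_disjoint)
      show "\<forall>i\<in>?J. \<forall>j\<in>?J. i \<noteq> j \<longrightarrow> set (bs ! i) \<inter> set (bs ! j) = {}"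
        using below_disjoint[OF blocks_nth[OF b]] by blast
    qed auto
    moreover have "(\<Sum>j\<in>?J. card (set (bs ! j))) = (\<Sum>j\<in>?J. length (bs ! j))"
      by (intro sum.cong) (auto simp: ne distinct_card)
    ultimately show ?thesis by simp
  qed
  have "map (\<lambda>i. map (\<lambda>x. x + (\<Sum>j | j < length (std (map hd bs)) \<and>
        std (map hd bs) ! j < std (map hd bs) ! i. length (map std bs ! j))) (map std bs ! i))
      [0..<length (std (map hd bs))] = map (map (\<lambda>x. card {y \<in> set (concat bs). y \<le> x})) bs"
  proof (rule nth_equalityI)
    fix i assume "i < length (map (\<lambda>i. map (\<lambda>x. x + (\<Sum>j | j < length (std (map hd bs)) \<and>
        std (map hd bs) ! j < std (map hd bs) ! i. length (map std bs ! j))) (map std bs ! i))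
      [0..<length (std (map hd bs))])"
    then have i: "i < length bs" by simp
    have "(\<Sum>j | j < length bs \<and> std (map hd bs) ! j < std (map hd bs) ! i. length (map std bs ! j))
      = (\<Sum>j | j < length bs \<and> hd (bs ! j) < hd (bs ! i). length (bs ! j))"
      by (intro sum.cong) (auto simp: hd[OF i])
    then show "map (\<lambda>i. map (\<lambda>x. x + (\<Sum>j | j < length (std (map hd bs)) \<and>
        std (map hd bs) ! j < std (map hd bs) ! i. length (map std bs ! j))) (map std bs ! i))
      [0..<length (std (map hd bs))] ! i = map (map (\<lambda>x. card {y \<in> set (concat bs). y \<le> x})) bs ! i"
      using i rank[OF i] by (simp add: std_def)
  qed simp
  then show ?thesis by (simp add: inflate_def std_def[of "concat bs"] map_concat)
qed

text \<open>Converse of \<open>inflate_std\<close>: the shifted copies concatenated by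
  \<open>inflate\<close> are the blocks. They are ordered like the entries of \<beta>, since the
  shift belonging to a larger entry counts block \<open>i\<close> in addition to everything counted
  in the shift of \<open>i\<close>.\<close>

lemma inflate_blocks:
  assumes \<beta>: "is_perm \<beta>" and len: "length \<nu>s = length \<beta>" and \<nu>s: "\<forall>\<mu>\<in>set \<nu>s. is_perm \<mu>"
  obtains bs where "blocks bs" "concat bs = inflate \<beta> \<nu>s" "std (map hd bs) = \<beta>" "map std bs = \<nu>s"
proof -
  define off where "off i = (\<Sum>j | j < length \<beta> \<and> \<beta> ! j < \<beta> ! i. length (\<nu>s ! j))" for i
  define bs where "bs = map (\<lambda>i. map (\<lambda>x. x + off i) (\<nu>s ! i)) [0..<length \<beta>]"
  have nth: "bs ! i = map (\<lambda>x. x + off i) (\<nu>s ! i)" if "i < length \<beta>" for i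
    using that by (simp add: bs_def)
  have P: "is_perm (\<nu>s ! i)" if "i < length \<beta>" for i
    using \<nu>s len that by simp
  have off: "off i + length (\<nu>s ! i) \<le> off j" if "i < length \<beta>" "\<beta> ! i < \<beta> ! j" for i j
  proof -
    have "off i + length (\<nu>s ! i) = (\<Sum>k \<in> insert i {k. k < length \<beta> \<and> \<beta> ! k < \<beta> ! i}. length (\<nu>s ! k))"
      by (subst sum.insert) (auto simp: off_def)
    also have "\<dots> \<le> off j" unfolding off_def by (intro sum_mono2) (use that in auto)
    finally show ?thesis .
  qed
  have lt: "bs ! i \<lless> bs ! j" if ij: "i < length \<beta>" "j < length \<beta>" "\<beta> ! i < \<beta> ! j" for i j
    using off[OF ij(1,3)] P[OF ij(1)] P[OF ij(2)] by (fastforce simp: below_def nth ij is_perm_def)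
  have lbs: "length bs = length \<beta>" by (simp add: bs_def)
  have cmp: "bs ! i \<lless> bs ! j \<or> bs ! j \<lless> bs ! i" if "i < length \<beta>" "j < length \<beta>" "i \<noteq> j" for i j
    using lt[of i j] lt[of j i] that \<beta> by (metis is_perm_def linorder_neqE_nat nth_eq_iff_index_eq)
  have ne: "bs ! i \<noteq> []" if "i < length \<beta>" for i
    using P[OF that] that by (simp add: nth is_perm_def)
  have "blocks bs"
    unfolding blocks_def
  proof
    show "\<forall>b\<in>set bs. b \<noteq> [] \<and> distinct b"
      using P by (auto simp: bs_def is_perm_def distinct_map inj_on_def)
    show "sorted_wrt (\<lambda>a b. a \<lless> b \<or> b \<lless> a) bs"
      unfolding sorted_wrt_iff_nth_less using cmp lbs by auto
  qed
  moreover have "concat bs = inflate \<beta> \<nu>s"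
    by (simp add: bs_def inflate_def off_def)
  moreover have "std (map hd bs) = \<beta>"
  proof -
    have "order_iso \<beta> (map hd bs)"
      unfolding order_iso_def
    proof (intro conjI allI impI)
      fix i j assume ij: "i < length \<beta>" "j < length \<beta>"
      have "hd (bs ! i) < hd (bs ! j)" if "\<beta> ! i < \<beta> ! j" "i < length \<beta>" "j < length \<beta>" for i j
        using lt[of i j] ne that by (auto simp: below_def)
      from this[of i j] this[of j i] have "\<beta> ! i < \<beta> ! j \<longleftrightarrow> hd (bs ! i) < hd (bs ! j)"
        using ij \<beta> by (metis is_perm_def linorder_neqE_nat nth_eq_iff_index_eq order_less_asym)
      then show "\<beta> ! i < \<beta> ! j \<longleftrightarrow> map hd bs ! i < map hd bs ! j"
        using ij lbs by simp
    qed (simp add: lbs)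
    then show ?thesis using std_cong[of \<beta> "map hd bs"] std_perm[OF \<beta>] \<beta> by (simp add: is_perm_def)
  qed
  moreover have "map std bs = \<nu>s"
  proof (rule nth_equalityI)
    fix i assume "i < length (map std bs)"
    then have i: "i < length \<beta>" by (simp add: lbs)
    have "order_iso (\<nu>s ! i) (bs ! i)" using i by (simp add: nth order_iso_def)
    then show "map std bs ! i = \<nu>s ! i"
      using std_cong[of "\<nu>s ! i" "bs ! i"] P[OF i] i lbs by (simp add: std_perm is_perm_def)
  qed (simp add: lbs len)
  ultimately show thesis by (rule that)
qed

section \<open>Splittable and simple lists\<close>

definition splittable :: "(nat \<Rightarrow> nat \<Rightarrow> bool) \<Rightarrow> nat list \<Rightarrow> bool" where
  "splittable R xs \<longleftrightarrow> (\<exists>ys zs. xs = ys @ zs \<and> ys \<noteq> [] \<and> zs \<noteq> [] \<and> (\<forall>y\<in>set ys. \<forall>z\<in>set zs. R y z))"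

lemma splittable_map:
  assumes "\<And>x y. x \<in> set xs \<Longrightarrow> y \<in> set xs \<Longrightarrow> R (f x) (f y) \<longleftrightarrow> R x y"
  shows "splittable R (map f xs) \<longleftrightarrow> splittable R xs"
proof
  assume "splittable R (map f xs)"
  then obtain ys zs where *: "map f xs = ys @ zs" "ys \<noteq> []" "zs \<noteq> []" "\<forall>y\<in>set ys. \<forall>z\<in>set zs. R y z"
    by (auto simp: splittable_def)
  then obtain us vs where "xs = us @ vs" "ys = map f us" "zs = map f vs"
    by (auto simp: map_eq_append_conv)
  with * assms show "splittable R xs" unfolding splittable_def
    by (intro exI[of _ us] exI[of _ vs]) auto
next
  assume "splittable R xs"
  then obtain ys zs where "xs = ys @ zs" "ys \<noteq> []" "zs \<noteq> []" "\<forall>y\<in>set ys. \<forall>z\<in>set zs. R y z"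
    by (auto simp: splittable_def)
  with assms show "splittable R (map f xs)" unfolding splittable_def
    by (intro exI[of _ "map f ys"] exI[of _ "map f zs"]) auto
qed

lemma splittable_std:
  "splittable (<) (std xs) \<longleftrightarrow> splittable (<) xs"
  "splittable (>) (std xs) \<longleftrightarrow> splittable (>) xs"
proof -
  obtain f where "strict_mono_on (set xs) f" "std xs = map f xs" using std_eq_map by blast
  then show "splittable (<) (std xs) \<longleftrightarrow> splittable (<) xs" "splittable (>) (std xs) \<longleftrightarrow> splittable (>) xs"
    by (simp_all add: splittable_map strict_mono_on_less)
qed

text \<open>The first and the last entry fall on different sides of any splitting, so their order
  reveals its direction.\<close>

lemma splittable_asym: "splittable (<) xs \<Longrightarrow> \<not> splittable (>) xs"
proof -
  have "R (hd xs) (last xs)" if "splittable R xs" for R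
  proof -
    obtain ys zs where "xs = ys @ zs" "ys \<noteq> []" "zs \<noteq> []" "\<forall>y\<in>set ys. \<forall>z\<in>set zs. R y z"
      using \<open>splittable R xs\<close> unfolding splittable_def by blast
    then show ?thesis by simp
  qed
  from this[of "(<)"] this[of "(>)"] show "splittable (<) xs \<Longrightarrow> \<not> splittable (>) xs" by force
qed

lemma sorted_blocks_splittable:
  assumes "sorted_wrt (\<lambda>a b. \<forall>x\<in>set a. \<forall>y\<in>set b. R x y) bs" "[] \<notin> set bs" "2 \<le> length bs"
  shows "splittable R (concat bs)"
proof -
  from assms(3) obtain a b cs where "bs = a # b # cs"
    by (metis One_nat_def Suc_1 Suc_le_length_iff)
  with assms show ?thesis unfolding splittable_def
    by (intro exI[of _ a] exI[of _ "concat (b # cs)"]) auto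
qed

text \<open>If the first blocks differ, one is a proper prefix of the other. The rest of the longer
  one comes from later blocks of the other list, so it is related by \<open>R\<close> to the prefix,
  and the longer block would be splittable.\<close>

lemma sorted_blocks_unique:
  assumes "concat bs = concat cs"
    and "sorted_wrt (\<lambda>a b. \<forall>x\<in>set a. \<forall>y\<in>set b. R x y) bs"
    and "sorted_wrt (\<lambda>a b. \<forall>x\<in>set a. \<forall>y\<in>set b. R x y) cs"
    and "\<forall>b\<in>set bs. b \<noteq> [] \<and> \<not> splittable R b" and "\<forall>c\<in>set cs. c \<noteq> [] \<and> \<not> splittable R c"
  shows "bs = cs"
  using assms
proof (induction bs arbitrary: cs)
  case Nil
  then show ?case by (cases cs) auto
next
  case (Cons a as)
  then obtain b bs where cs: "cs = b # bs" by (cases cs) auto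
  have key: "us = []"
    if "b = a @ us" "concat as = us @ concat bs" "a \<noteq> []" "\<not> splittable R b"
      "sorted_wrt (\<lambda>a b. \<forall>x\<in>set a. \<forall>y\<in>set b. R x y) (a # as)" for a b us and as bs :: "nat list list"
  proof (rule ccontr)
    assume "us \<noteq> []"
    moreover have "set us \<subseteq> set (concat as)" unfolding that(2) by auto
    then have "\<forall>x\<in>set a. \<forall>y\<in>set us. R x y" using that(5) by auto
    ultimately have "splittable R b" unfolding splittable_def using that(1,3) by blast
    with that show False by simp
  qed
  have "a @ concat as = b @ concat bs" using Cons.prems(1) cs by simp
  then consider us where "a = b @ us" "us @ concat as = concat bs" | us where "a @ us = b" "concat as = us @ concat bs"
    unfolding append_eq_append_conv2 by blast
  then have "a = b \<and> concat as = concat bs"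
  proof cases
    case (1 us)
    have "us = []"
      by (rule key[of a b us bs as]) (use 1 Cons.prems(2-5) cs in simp_all)
    with 1 show ?thesis by simp
  next
    case (2 us)
    have "us = []"
      by (rule key[of b a us as bs]) (use 2 Cons.prems(2-5) cs in simp_all)
    with 2 show ?thesis by simp
  qed
  with Cons.IH[of bs] Cons.prems(2-5) cs show ?case by simp
qed

text \<open>Cut a splittable list and treat both halves in the same way; the relation across the cut
  passes to all pieces, whose entries are entries of the halves.\<close>

lemma sorted_blocks_exist:
  assumes "xs \<noteq> []"
  shows "\<exists>bs. concat bs = xs \<and> sorted_wrt (\<lambda>a b. \<forall>x\<in>set a. \<forall>y\<in>set b. R x y) bs \<and>
    (\<forall>b\<in>set bs. b \<noteq> [] \<and> \<not> splittable R b)"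
  using assms
proof (induction xs rule: length_induct)
  case (1 xs)
  show ?case
  proof (cases "splittable R xs")
    case False
    with "1.prems" show ?thesis by (intro exI[of _ "[xs]"]) auto
  next
    case True
    then obtain ys zs where s: "xs = ys @ zs" "ys \<noteq> []" "zs \<noteq> []" "\<forall>y\<in>set ys. \<forall>z\<in>set zs. R y z"
      by (auto simp: splittable_def)
    then obtain as bs where
      as: "concat as = ys" "sorted_wrt (\<lambda>a b. \<forall>x\<in>set a. \<forall>y\<in>set b. R x y) as"
        "\<forall>b\<in>set as. b \<noteq> [] \<and> \<not> splittable R b" and
      bs: "concat bs = zs" "sorted_wrt (\<lambda>a b. \<forall>x\<in>set a. \<forall>y\<in>set b. R x y) bs"
        "\<forall>b\<in>set bs. b \<noteq> [] \<and> \<not> splittable R b"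
      using "1.IH"[rule_format, of ys] "1.IH"[rule_format, of zs] by auto
    have "\<forall>a\<in>set as. \<forall>b\<in>set bs. \<forall>x\<in>set a. \<forall>y\<in>set b. R x y"
      using s(4) as(1) bs(1) by auto
    then have "sorted_wrt (\<lambda>a b. \<forall>x\<in>set a. \<forall>y\<in>set b. R x y) (as @ bs)"
      using as(2) bs(2) by (simp add: sorted_wrt_append)
    then show ?thesis
      using as(1,3) bs(1,3) s(1) by (intro exI[of _ "as @ bs"]) auto
  qed
qed

text \<open>An interval relative to the remaining entries \<open>zs\<close>: the values of
  \<open>ys\<close> need not be consecutive integers, so the notion makes sense for blocks and for
  lists of heads. Inside a permutation it becomes an interval of values.\<close>

definition interval_in :: "nat list \<Rightarrow> nat list \<Rightarrow> bool" where
  "interval_in ys zs \<longleftrightarrow> (\<forall>z\<in>set zs. (\<forall>y\<in>set ys. z < y) \<or> (\<forall>y\<in>set ys. y < z))"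

definition simple_list :: "nat list \<Rightarrow> bool" where
  "simple_list xs \<longleftrightarrow> 2 < length xs \<and>
    (\<forall>as ys cs. xs = as @ ys @ cs \<and> 2 \<le> length ys \<and> interval_in ys (as @ cs) \<longrightarrow> as = [] \<and> cs = [])"

lemma simple_list_map:
  assumes f: "strict_mono_on (set xs) f"
  shows "simple_list (map f xs) \<longleftrightarrow> simple_list xs"
proof -
  have *: "interval_in (map f ys) (map f as @ map f cs) \<longleftrightarrow> interval_in ys (as @ cs)"
    if "xs = as @ ys @ cs" for as ys cs
  proof -
    have "(f z < f y \<longleftrightarrow> z < y) \<and> (f y < f z \<longleftrightarrow> y < z)" if "z \<in> set (as @ cs)" "y \<in> set ys" for z y
      using that \<open>xs = as @ ys @ cs\<close> by (auto intro!: strict_mono_on_less[OF f])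
    then show ?thesis by (simp add: interval_in_def ball_Un)
  qed
  show ?thesis
  proof
    assume s: "simple_list (map f xs)"
    show "simple_list xs" unfolding simple_list_def
    proof (intro conjI allI impI; (elim conjE)?)
      show "2 < length xs" using s by (simp add: simple_list_def)
      fix as ys cs assume a: "xs = as @ ys @ cs" "2 \<le> length ys" "interval_in ys (as @ cs)"
      then have "map f as = [] \<and> map f cs = []"
        using s *[OF a(1)] unfolding simple_list_def by (metis length_map map_append)
      then show "as = []" "cs = []" by auto
    qed
  next
    assume s: "simple_list xs"
    show "simple_list (map f xs)" unfolding simple_list_def
    proof (intro conjI allI impI; (elim conjE)?)
      show "2 < length (map f xs)" using s by (simp add: simple_list_def)
      fix as ys cs assume a: "map f xs = as @ ys @ cs" "2 \<le> length ys" "interval_in ys (as @ cs)"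
      from a(1) obtain as' ys' cs' where "xs = as' @ ys' @ cs'" "as = map f as'" "ys = map f ys'" "cs = map f cs'"
        by (auto simp: map_eq_append_conv append_eq_map_conv)
      moreover from this have "as' = [] \<and> cs' = []"
        using s a *[of as' ys' cs'] unfolding simple_list_def by auto
      ultimately show "as = []" "cs = []" by auto
    qed
  qed
qed

lemma simple_perm_iff_simple_list:
  assumes \<sigma>: "is_perm \<sigma>"
  shows "simple_perm \<sigma> \<longleftrightarrow> simple_list \<sigma>"
proof
  assume s: "simple_perm \<sigma>"
  show "simple_list \<sigma>" unfolding simple_list_def
  proof (intro conjI allI impI; (elim conjE)?)
    show "2 < length \<sigma>" using s by (simp add: simple_perm_def)
    fix as ys cs assume a: "\<sigma> = as @ ys @ cs" "2 \<le> length ys" "interval_in ys (as @ cs)"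
    let ?i = "length as" and ?j = "length as + length ys - 1"
    have "(!) \<sigma> ` {?i..?j} = set ys"
    proof (intro equalityI subsetI)
      fix y assume "y \<in> (!) \<sigma> ` {?i..?j}"
      then obtain k where k: "?i \<le> k" "k \<le> ?j" "y = \<sigma> ! k" by auto
      then have "k - length as < length ys" using a by linarith
      with k show "y \<in> set ys" unfolding a(1) by (simp add: nth_append)
    next
      fix y assume "y \<in> set ys"
      then obtain k where k: "k < length ys" "y = ys ! k" by (auto simp: in_set_conv_nth)
      then have "y = \<sigma> ! (length as + k)" "length as + k \<in> {?i..?j}" unfolding a(1) by (auto simp: nth_append)
      then show "y \<in> (!) \<sigma> ` {?i..?j}" by blast
    qed
    \<comment> \<open>A value between the extremes that is missing from \<open>ys\<close> still
      occurs in \<sigma>, hence among the remaining entries, against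
      \<open>interval_in\<close>.\<close>
    also have "set ys = {Min (set ys)..Max (set ys)}"
    proof -
      have ne: "set ys \<noteq> {}" "finite (set ys)" using a by auto
      have "v \<in> set ys" if v: "Min (set ys) \<le> v" "v \<le> Max (set ys)" for v
      proof (rule ccontr)
        assume n: "v \<notin> set ys"
        have m: "Min (set ys) \<in> set ys" "Max (set ys) \<in> set ys" using ne by auto
        have "set ys \<subseteq> set \<sigma>" using a(1) by auto
        moreover have "set \<sigma> = {1..length \<sigma>}" using \<sigma> by (simp add: is_perm_def)
        ultimately have "1 \<le> Min (set ys)" "Max (set ys) \<le> length \<sigma>" using m by (metis atLeastAtMost_iff subsetD)+
        then have "v \<in> set \<sigma>" using v \<open>set \<sigma> = {1..length \<sigma>}\<close> by simp
        then have "v \<in> set (as @ cs)" using n unfolding a(1) by simp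
        then show False using a(3) m v unfolding interval_in_def by (meson not_le)
      qed
      then show ?thesis using Min_le[OF ne(2)] Max_ge[OF ne(2)] by (meson atLeastAtMost_iff subsetI subset_antisym)
    qed
    finally have ex: "\<exists>a b. (!) \<sigma> ` {?i..?j} = {a..b}" by (intro exI)
    have "\<not> (card {?i..?j} \<le> length \<sigma> - 1)"
    proof
      assume "card {?i..?j} \<le> length \<sigma> - 1"
      moreover have "?i < ?j" "?j < length \<sigma>" using a by auto
      ultimately have "\<not> (\<exists>a b. (!) \<sigma> ` {?i..?j} = {a..b})"
        using s[unfolded simple_perm_def, THEN conjunct2, THEN conjunct2, rule_format, of ?i ?j] by simp
      with ex show False by contradiction
    qed
    moreover have "card {?i..?j} = length ys" using a(2) by simp
    moreover have "length \<sigma> = length as + length ys + length cs" using a(1) by simp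
    ultimately have "length as + length cs = 0" using a(2) by linarith
    then show "as = []" "cs = []" by auto
  qed
next
  assume s: "simple_list \<sigma>"
  show "simple_perm \<sigma>" unfolding simple_perm_def
  proof (intro conjI allI impI notI; (elim conjE exE)?)
    show "2 < length \<sigma>" using s by (simp add: simple_list_def)
    fix i j a b
    assume ij: "i < j" "j < length \<sigma>" "card {i..j} \<le> length \<sigma> - 1" and im: "(!) \<sigma> ` {i..j} = {a..b}"
    define as ys cs where "as = take i \<sigma>" and "ys = drop i (take (Suc j) \<sigma>)" and "cs = drop (Suc j) \<sigma>"
    have \<sigma>': "\<sigma> = as @ ys @ cs"
    proof -
      have "\<sigma> = take (Suc j) \<sigma> @ cs" by (simp add: cs_def)
      also have "take (Suc j) \<sigma> = take i (take (Suc j) \<sigma>) @ ys" by (simp only: ys_def append_take_drop_id)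
      also have "take i (take (Suc j) \<sigma>) = as" using ij by (simp add: as_def)
      finally show ?thesis by simp
    qed
    have l: "length as = i" "length ys = Suc j - i" using ij by (auto simp: as_def ys_def)
    have "set ys = (!) \<sigma> ` {i..j}"
    proof -
      have "set ys = (!) ys ` {..<Suc j - i}" unfolding l(2)[symmetric] by (auto simp: in_set_conv_nth)
      also have "\<dots> = (\<lambda>k. \<sigma> ! (i + k)) ` {..<Suc j - i}"
        using ij by (intro image_cong) (auto simp: ys_def)
      also have "\<dots> = (!) \<sigma> ` ((+) i ` {..<Suc j - i})" by (simp add: image_image)
      also have "(+) i ` {..<Suc j - i} = {i..j}"
        using ij by (simp add: lessThan_atLeast0 atLeastLessThanSuc_atLeastAtMost)
      finally show ?thesis .
    qed
    then have ys: "set ys = {a..b}" using im by simp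
    have "distinct (as @ ys @ cs)" using \<sigma> unfolding is_perm_def \<sigma>'[symmetric] by simp
    then have "set ys \<inter> set (as @ cs) = {}" by auto
    then have "z < a \<or> b < z" if "z \<in> set (as @ cs)" for z
      using that unfolding ys by (metis atLeastAtMost_iff disjoint_iff not_le)
    then have "interval_in ys (as @ cs)" unfolding interval_in_def ys by fastforce
    moreover have "2 \<le> length ys" using l ij by simp
    ultimately have "as = [] \<and> cs = []"
      using s[unfolded simple_list_def, THEN conjunct2, rule_format, of as ys cs] \<sigma>' by blast
    then have "length \<sigma> = length ys" using \<sigma>' by simp
    then show False using ij l by simp
  qed (fact \<sigma>)
qed

lemma simple_perm_std:
  assumes "distinct xs"
  shows "simple_perm (std xs) \<longleftrightarrow> simple_list xs"
proof (cases "xs = []")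
  case True
  then show ?thesis by (simp add: simple_perm_def simple_list_def)
next
  case False
  obtain f where "strict_mono_on (set xs) f" "std xs = map f xs" using std_eq_map by blast
  with simple_perm_iff_simple_list[OF is_perm_std[OF False assms]] show ?thesis
    by (simp add: simple_list_map)
qed

section \<open>Uniqueness of the simple quotient\<close>

lemma blocks_eqI:
  assumes "blocks bs" "b \<in> set bs" "c \<in> set bs" "x \<in> set b" "x \<in> set c"
  shows "b = c"
proof (rule ccontr)
  assume "b \<noteq> c"
  obtain i j where "i < length bs" "b = bs ! i" "j < length bs" "c = bs ! j"
    using assms(2,3) by (auto simp: in_set_conv_nth)
  with \<open>b \<noteq> c\<close> have "b \<lless> c \<or> c \<lless> b" using blocks_nth[OF assms(1), of i j] by auto
  with below_disjoint assms(4,5) show False by blast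
qed

lemma blocks_comparable:
  assumes "blocks bs" "b \<in> set bs" "c \<in> set bs" "b \<noteq> c"
  shows "b \<lless> c \<or> c \<lless> b"
proof -
  obtain i j where "i < length bs" "b = bs ! i" "j < length bs" "c = bs ! j"
    using assms(2,3) by (auto simp: in_set_conv_nth)
  with \<open>b \<noteq> c\<close> show ?thesis using blocks_nth[OF assms(1), of i j] by auto
qed

lemma blocks_distinct: "blocks bs \<Longrightarrow> distinct bs"
  using blocks_distinct_concat[of bs] by (auto simp: distinct_concat_iff blocks_def)

lemma blocks_nonempty: "blocks bs \<Longrightarrow> b \<in> set bs \<Longrightarrow> b \<noteq> []"
  by (simp add: blocks_def)

lemma blocks_distinct_hd: "blocks bs \<Longrightarrow> distinct (map hd bs)"
  unfolding distinct_map inj_on_def using blocks_distinct blocks_nonempty blocks_eqI hd_in_set by metis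

text \<open>The cut is located in the block \<open>p @ r\<close>. A cut between two blocks could be
  assigned to either; demanding \<open>r\<close> nonempty picks the block after it, while
  \<open>concat_split_left\<close> picks the one before. Used together they find the first and the
  last block that an infix meets.\<close>

lemma concat_split_right:
  assumes "concat bs = us @ ws" "ws \<noteq> []" "[] \<notin> set bs"
  obtains A p r B where "bs = A @ (p @ r) # B" "us = concat A @ p" "ws = r @ concat B" "r \<noteq> []"
proof -
  have "bs \<noteq> []" using assms by auto
  then obtain A p r B where *: "bs = A @ (p @ r) # B" "us = concat A @ p" "ws = r @ concat B"
    using concat_eq_appendD[OF assms(1)] by blast
  show thesis
  proof (cases "r = []")
    case False
    with * show thesis using that by blast
  next
    case True
    then obtain b B' where "B = b # B'" using * assms(2) by (cases B) auto
    then show thesis using that[of "A @ [p]" "[]" b B'] * assms(3) True by auto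
  qed
qed

lemma concat_split_left:
  assumes "concat bs = us @ ws" "us \<noteq> []" "[] \<notin> set bs"
  obtains A p r B where "bs = A @ (p @ r) # B" "us = concat A @ p" "ws = r @ concat B" "p \<noteq> []"
proof -
  have "bs \<noteq> []" using assms by auto
  then obtain A p r B where *: "bs = A @ (p @ r) # B" "us = concat A @ p" "ws = r @ concat B"
    using concat_eq_appendD[OF assms(1)] by blast
  show thesis
  proof (cases "p = []")
    case False
    with * show thesis using that by blast
  next
    case True
    then obtain b A' where "A = A' @ [b]" using * assms(2) by (cases A rule: rev_cases) auto
    then show thesis using that[of A' b "[]" "r # B"] * assms(3) True by auto
  qed
qed

lemma below_hd:
  assumes "a \<lless> b \<or> b \<lless> a" "a \<noteq> []" "b \<noteq> []"
  shows "hd a < hd b \<longleftrightarrow> a \<lless> b"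
  using below_iff[OF assms(1), of "hd a" "hd b"] assms by simp

lemma interval_in_simple_blocks:
  assumes b: "blocks bs" and s: "simple_list (map hd bs)"
    and split: "concat bs = us @ ys @ vs" and ys: "ys \<noteq> []" and proper: "us @ vs \<noteq> []"
    and int: "interval_in ys (us @ vs)"
  shows "\<exists>b\<in>set bs. set ys \<subseteq> set b"
proof -
  have ne: "[] \<notin> set bs" using b by (auto simp: blocks_def)
  have "ys @ vs \<noteq> []" using ys by simp
  from concat_split_right[OF split this ne]
  obtain A p r B where A: "bs = A @ (p @ r) # B" "us = concat A @ p" "ys @ vs = r @ concat B" "r \<noteq> []"
    by blast
  have "concat (r # B) = ys @ vs" "[] \<notin> set (r # B)" using A ne by auto
  from concat_split_left[OF this(1) ys this(2)]
  obtain D q t E where D: "r # B = D @ (q @ t) # E" "ys = concat D @ q" "vs = t @ concat E" "q \<noteq> []"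
    by blast
  show ?thesis
  proof (cases D)
    \<comment> \<open>Both cuts fall in the same block, which then contains
      \<open>ys\<close>.\<close>
    case Nil
    then show ?thesis using A D by auto
  next
    case (Cons d F)
    then have B: "B = F @ (q @ t) # E" "d = r" using D by auto
    \<comment> \<open>\<open>M\<close> is the run of blocks met by \<open>ys\<close>; its heads form an interval of \<open>map hd bs\<close>, so \<open>M\<close> is everything.
      If then \<open>ys\<close> misses part of an end block, the heads of the other blocks form a proper interval.\<close>
    define M where "M = (p @ r) # F @ [q @ t]"
    have bs: "bs = A @ M @ E" using A B by (simp add: M_def)
    have ys': "ys = r @ concat F @ q" using D Cons B by simp
    have meets: "\<exists>x\<in>set ys. x \<in> set m" if m: "m \<in> set M" for m
    proof -
      consider "m = p @ r" | "m \<in> set F" | "m = q @ t" using m by (auto simp: M_def)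
      then show ?thesis
      proof cases
        case 1
        then show ?thesis using A(4) ys' by (intro bexI[of _ "hd r"]) auto
      next
        case 2
        moreover from this have "m \<noteq> []" using ne bs M_def by auto
        ultimately show ?thesis using ys' by (intro bexI[of _ "hd m"]) (auto intro: bexI[of _ m])
      next
        case 3
        then show ?thesis using D(4) ys' by (intro bexI[of _ "hd q"]) auto
      qed
    qed
    \<comment> \<open>\<open>z\<close> lies outside \<open>ys\<close>, hence above or below all of
      it, while every block of \<open>M\<close> meets \<open>ys\<close>; comparability of blocks
      carries this over to the heads. When an end block is cut, \<open>a\<close> belongs to
      \<open>M\<close> itself, which is why it is kept out of \<open>M'\<close>.\<close>
    have side: "(\<forall>m\<in>M'. hd a < hd m) \<or> (\<forall>m\<in>M'. hd m < hd a)"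
      if a: "a \<in> set bs" "z \<in> set a" "z \<in> set (us @ vs)" and M': "M' \<subseteq> set M" "a \<notin> M'" for a z M'
    proof -
      have *: "hd a < hd m \<and> z < x \<or> hd m < hd a \<and> x < z"
        if m: "m \<in> M'" and x: "x \<in> set ys" "x \<in> set m" for m x
      proof -
        have mb: "m \<in> set bs" "a \<noteq> m" using m M' bs by auto
        have cmp: "a \<lless> m \<or> m \<lless> a" using blocks_comparable[OF b a(1) mb] .
        have "a \<noteq> []" "m \<noteq> []" using blocks_nonempty[OF b] mb a by auto
        with cmp show ?thesis using a(2) x(2) unfolding below_def by (meson hd_in_set)
      qed
      have "(\<forall>y\<in>set ys. z < y) \<or> (\<forall>y\<in>set ys. y < z)" using int a(3) unfolding interval_in_def by blast
      then show ?thesis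
      proof
        assume "\<forall>y\<in>set ys. z < y"
        then have "hd a < hd m" if "m \<in> M'" for m
          using *[OF that] meets[of m] M'(1) that by (meson less_asym subsetD)
        then show ?thesis by blast
      next
        assume "\<forall>y\<in>set ys. y < z"
        then have "hd m < hd a" if "m \<in> M'" for m
          using *[OF that] meets[of m] M'(1) that by (meson less_asym subsetD)
        then show ?thesis by blast
      qed
    qed
    have hdM: "interval_in (map hd M) (map hd A @ map hd E)"
    proof -
      have "(\<forall>m\<in>set M. hd a < hd m) \<or> (\<forall>m\<in>set M. hd m < hd a)" if a: "a \<in> set A \<union> set E" for a
      proof (rule side)
        show "a \<in> set bs" using a bs by auto
        then show "hd a \<in> set a" using blocks_nonempty[OF b] by auto
        then show "hd a \<in> set (us @ vs)" using a A(2) D(3) by auto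
        show "a \<notin> set M" using blocks_distinct[OF b] a unfolding bs by auto
      qed simp
      then show ?thesis unfolding interval_in_def by auto
    qed
    have simple: "as = [] \<and> cs = []"
      if "map hd bs = as @ ms @ cs" "2 \<le> length ms" "interval_in ms (as @ cs)" for as ms cs
      using s that unfolding simple_list_def by blast
    have "map hd A = [] \<and> map hd E = []"
      by (rule simple[OF _ _ hdM]) (use bs in \<open>auto simp: M_def\<close>)
    then have AE: "A = []" "E = []" by auto
    then have bsM: "bs = M" using bs by simp
    \<comment> \<open>A simple list has more than two entries, so dropping an end block leaves at
      least two heads.\<close>
    have len: "2 \<le> length (F @ [q @ t])" "2 \<le> length ((p @ r) # F)"
      using s bsM unfolding simple_list_def M_def by (auto simp: Suc_le_eq)
    have "p \<noteq> [] \<or> t \<noteq> []" using proper A(2) D(3) AE by auto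
    then show ?thesis
    proof
      assume p: "p \<noteq> []"
      have "(\<forall>m\<in>set (F @ [q @ t]). hd (p @ r) < hd m) \<or> (\<forall>m\<in>set (F @ [q @ t]). hd m < hd (p @ r))"
      proof (rule side)
        show "hd p \<in> set (p @ r)" "hd p \<in> set (us @ vs)" using p A(2) by auto
        show "p @ r \<notin> set (F @ [q @ t])" using blocks_distinct[OF b] unfolding bsM M_def by auto
      qed (auto simp: bsM M_def)
      then have "interval_in (map hd (F @ [q @ t])) ([hd (p @ r)] @ [])" unfolding interval_in_def by auto
      from simple[OF _ _ this] len show ?thesis by (simp add: bsM M_def)
    next
      assume t: "t \<noteq> []"
      have "(\<forall>m\<in>set ((p @ r) # F). hd (q @ t) < hd m) \<or> (\<forall>m\<in>set ((p @ r) # F). hd m < hd (q @ t))"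
      proof (rule side)
        show "hd t \<in> set (q @ t)" "hd t \<in> set (us @ vs)" using t D(3) by auto
        show "q @ t \<notin> set ((p @ r) # F)" using blocks_distinct[OF b] unfolding bsM M_def by auto
      qed (auto simp: bsM M_def)
      then have "interval_in (map hd ((p @ r) # F)) ([] @ [hd (q @ t)])" unfolding interval_in_def by auto
      from simple[OF _ _ this] len show ?thesis by (simp add: bsM M_def)
    qed
  qed
qed

text \<open>Both halves of a splitting are proper intervals, so each would lie in a single block.
  There would be at most two blocks in all, whereas a simple quotient has more.\<close>

lemma simple_blocks_not_splittable:
  assumes b: "blocks bs" and s: "simple_list (map hd bs)"
  shows "\<not> splittable (<) (concat bs)" "\<not> splittable (>) (concat bs)"
proof -
  have False if R: "R = (<) \<or> R = (>)" and sp: "splittable R (concat bs)" for R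
  proof -
    obtain ys zs where yz: "concat bs = ys @ zs" "ys \<noteq> []" "zs \<noteq> []" "\<forall>y\<in>set ys. \<forall>z\<in>set zs. R y z"
      using sp unfolding splittable_def by blast
    have "interval_in ys zs" "interval_in zs ys" using R yz(4) unfolding interval_in_def by auto
    then obtain c d where c: "c \<in> set bs" "set ys \<subseteq> set c" and d: "d \<in> set bs" "set zs \<subseteq> set d"
      using interval_in_simple_blocks[OF b s, of "[]" ys zs]
        interval_in_simple_blocks[OF b s, of ys zs "[]"] yz by auto
    have "set bs \<subseteq> {c, d}"
    proof
      fix e assume e: "e \<in> set bs"
      then have "hd e \<in> set e" using blocks_nonempty[OF b] by auto
      moreover from this have "hd e \<in> set (ys @ zs)" using e unfolding yz(1)[symmetric] by auto
      ultimately show "e \<in> {c, d}" using blocks_eqI[OF b e] c d by auto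
    qed
    then have "card (set bs) \<le> card {c, d}" by (intro card_mono) auto
    also have "\<dots> \<le> 2" by (cases "c = d") auto
    finally have "card (set bs) \<le> 2" .
    then show False using distinct_card[OF blocks_distinct[OF b]] s unfolding simple_list_def by simp
  qed
  then show "\<not> splittable (<) (concat bs)" "\<not> splittable (>) (concat bs)" by blast+
qed

text \<open>Of the two first blocks one is a prefix of the other, and the longer is contained in
  some block of the other list. That block shares an element with the prefix, so it is the prefix
  itself and the two agree.\<close>

lemma refined_blocks_eq:
  assumes "concat bs = concat cs" "blocks bs" "blocks cs"
    and "\<forall>b\<in>set bs. \<exists>c\<in>set cs. set b \<subseteq> set c" "\<forall>c\<in>set cs. \<exists>b\<in>set bs. set c \<subseteq> set b"
  shows "bs = cs"
  using assms
proof (induction bs arbitrary: cs)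
  case Nil
  then show ?case by (cases cs) (auto simp: blocks_def)
next
  case (Cons a as)
  have "cs \<noteq> []" using Cons.prems(1,2) by (auto simp: blocks_Cons)
  then obtain b bs where cs: "cs = b # bs" by (cases cs) auto
  have key: "us = []" if h: "a @ us = b" "blocks (a # as)" "distinct b" "\<exists>c\<in>set (a # as). set b \<subseteq> set c" for a b us as
  proof -
    obtain c where c: "c \<in> set (a # as)" "set b \<subseteq> set c" using h(4) by blast
    have "a \<noteq> []" using h(2) by (simp add: blocks_def)
    then have "hd a \<in> set a" "hd a \<in> set c" using c(2) h(1) by (auto simp: subset_iff)
    then have "c = a" using blocks_eqI[OF h(2) c(1), of a "hd a"] by simp
    then show ?thesis using c(2) h(1,3) by (cases us) auto
  qed
  have "a @ concat as = b @ concat bs" using Cons.prems(1) cs by simp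
  then consider us where "a = b @ us" | us where "a @ us = b"
    unfolding append_eq_append_conv2 by blast
  then have ab: "a = b"
  proof cases
    case (1 us)
    have "us = []"
      by (rule key[of b us a bs]) (use 1 Cons.prems(2-5) cs in \<open>simp_all add: blocks_Cons\<close>)
    with 1 show ?thesis by simp
  next
    case (2 us)
    have "us = []"
      by (rule key[of a us b as]) (use 2 Cons.prems(2-5) cs in \<open>simp_all add: blocks_Cons\<close>)
    with 2 show ?thesis by simp
  qed
  have rest: "\<exists>c\<in>set bs. set d \<subseteq> set c"
    if "blocks (a # as)" "d \<in> set as" "\<exists>c\<in>set (a # bs). set d \<subseteq> set c" for as bs d
  proof -
    have "d \<noteq> []" "set a \<inter> set d = {}" using that(1,2) below_disjoint[of a d]
      by (auto simp: blocks_Cons dest: blocks_nonempty)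
    then have "\<not> set d \<subseteq> set a" by (cases d) auto
    with that(3) show ?thesis by auto
  qed
  have "as = bs"
  proof (rule Cons.IH)
    show "concat as = concat bs" using Cons.prems(1) cs ab by simp
    show "blocks as" "blocks bs" using Cons.prems cs by (auto simp: blocks_Cons)
    show "\<forall>b\<in>set as. \<exists>c\<in>set bs. set b \<subseteq> set c"
      using rest[OF Cons.prems(2), of _ bs] Cons.prems(4) cs ab by simp
    show "\<forall>b\<in>set bs. \<exists>c\<in>set as. set b \<subseteq> set c"
      using rest[of bs _ as] Cons.prems(3,5) cs ab by simp
  qed
  with ab cs show ?case by simp
qed

lemma blocks_interval_in:
  assumes b: "blocks (as @ b # cs)"
  shows "interval_in b (concat as @ concat cs)"
proof -
  have "b \<lless> a \<or> a \<lless> b" if "a \<in> set as \<union> set cs" for a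
    using that b by (auto simp: blocks_append blocks_Cons)
  then show ?thesis unfolding interval_in_def below_def by fastforce
qed

text \<open>A block of a decomposition into at least two blocks is a proper interval. Hence a
  decomposition with simple quotient is coarser than every nontrivial one.\<close>

lemma simple_blocks_refined:
  assumes "concat bs = concat cs" "blocks bs" "blocks cs" "simple_list (map hd bs)" "2 \<le> length cs"
    "c \<in> set cs"
  shows "\<exists>b\<in>set bs. set c \<subseteq> set b"
proof -
  obtain A B where cs: "cs = A @ c # B" using assms(6) split_list by metis
  have "A \<noteq> [] \<or> B \<noteq> []" using assms(5) cs by auto
  then have "concat A @ concat B \<noteq> []"
    using assms(3) unfolding cs by (auto simp: blocks_append blocks_Cons dest: blocks_nonempty) (metis blocks_nonempty last_in_set)+
  then show ?thesis
    using interval_in_simple_blocks[OF assms(2,4), of "concat A" c "concat B"] assms(1)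
      blocks_interval_in[of A c B] assms(3) blocks_nonempty[OF assms(3,6)] unfolding cs by simp
qed

lemma simple_blocks_unique:
  assumes "concat bs = concat cs" "blocks bs" "blocks cs" "simple_list (map hd bs)" "simple_list (map hd cs)"
  shows "bs = cs"
proof (rule refined_blocks_eq[OF assms(1-3)])
  have "2 \<le> length cs" "2 \<le> length bs" using assms(4,5) by (auto simp: simple_list_def)
  then show "\<forall>b\<in>set bs. \<exists>c\<in>set cs. set b \<subseteq> set c" "\<forall>c\<in>set cs. \<exists>b\<in>set bs. set c \<subseteq> set b"
    using simple_blocks_refined assms by metis+
qed

section \<open>Existence of canonical blocks\<close>

lemma sorted_blocks_is_blocks:
  assumes "sorted_wrt (\<lambda>a b. \<forall>x\<in>set a. \<forall>y\<in>set b. R x y) bs" "R = (<) \<or> R = (>)"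
    "\<forall>b\<in>set bs. b \<noteq> []" "distinct (concat bs)"
  shows "blocks bs"
proof -
  have "sorted_wrt (\<lambda>a b. a \<lless> b \<or> b \<lless> a) bs"
    by (rule sorted_wrt_mono_rel[OF _ assms(1)]) (use assms(2) in \<open>auto simp: below_def\<close>)
  then show ?thesis using assms(3,4) by (auto simp: blocks_def distinct_concat_iff)
qed

text \<open>Comparable nonempty blocks are ordered as their heads are, so sortedness of the
  decomposition is a property of its quotient.\<close>

lemma blocks_sorted_iff:
  assumes "blocks bs" "R = (<) \<or> R = (>)"
  shows "sorted_wrt (\<lambda>a b. \<forall>x\<in>set a. \<forall>y\<in>set b. R x y) bs \<longleftrightarrow> sorted_wrt R (map hd bs)"
proof -
  have "(\<forall>x\<in>set a. \<forall>y\<in>set b. R x y) \<longleftrightarrow> R (hd a) (hd b)" if "a \<lless> b \<or> b \<lless> a" "a \<noteq> []" "b \<noteq> []" for a b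
    using that assms(2) unfolding below_def by (meson hd_in_set less_asym)
  then have "(\<forall>x\<in>set (bs ! i). \<forall>y\<in>set (bs ! j). R x y) \<longleftrightarrow> R (hd (bs ! i)) (hd (bs ! j))"
    if "i < j" "j < length bs" for i j
    using that blocks_nth[OF assms(1), of i j] blocks_nonempty[OF assms(1)] by simp
  then show ?thesis
    unfolding sorted_wrt_map sorted_wrt_iff_nth_less by (intro iff_allI imp_cong) simp_all
qed

text \<open>The least number of blocks exists because the singletons form a decomposition. If an
  interval of at least two heads were proper, the blocks over it could be merged into one; at least
  two blocks would remain, but fewer than the minimum.\<close>

lemma exists_simple_blocks:
  assumes d: "distinct xs" and l: "2 \<le> length xs"
    and ns: "\<not> splittable (<) xs" "\<not> splittable (>) xs"
  shows "\<exists>bs. blocks bs \<and> concat bs = xs \<and> simple_list (map hd bs)"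
proof -
  let ?P = "\<lambda>bs. blocks bs \<and> concat bs = xs \<and> 2 \<le> length bs"
  have "?P (map (\<lambda>x. [x]) xs)"
  proof -
    have "sorted_wrt (\<lambda>x y. [x] \<lless> [y] \<or> [y] \<lless> [x]) xs"
      unfolding sorted_wrt_iff_nth_less using d by (auto simp: below_def distinct_conv_nth neq_iff)
    then show ?thesis using l by (auto simp: blocks_def sorted_wrt_map)
  qed
  then obtain bs where bs: "?P bs" and min: "\<And>cs. ?P cs \<Longrightarrow> length bs \<le> length cs"
    using ex_has_least_nat[of ?P _ length] by blast
  \<comment> \<open>Two comparable blocks would split \<open>xs\<close> in one of the two
    directions.\<close>
  have "length bs \<noteq> 2"
  proof
    assume "length bs = 2"
    then obtain a b where ab: "bs = [a, b]" by (auto simp: numeral_2_eq_2 length_Suc_conv)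
    then have "a \<lless> b \<or> b \<lless> a" "a \<noteq> []" "b \<noteq> []" "xs = a @ b" using bs by (auto simp: blocks_def)
    then have "splittable (<) xs \<or> splittable (>) xs" unfolding splittable_def below_def by blast
    with ns show False by blast
  qed
  have "as = [] \<and> cs = []"
    if h: "map hd bs = as @ ms @ cs" "2 \<le> length ms" "interval_in ms (as @ cs)" for as ms cs
  proof (rule ccontr)
    assume ne: "\<not> (as = [] \<and> cs = [])"
    obtain A M E where AME: "bs = A @ M @ E" "as = map hd A" "ms = map hd M" "cs = map hd E"
      using h(1) by (auto simp: map_eq_append_conv append_eq_map_conv)
    have b: "blocks A" "blocks M" "blocks E" and
      AM: "\<And>a m. a \<in> set A \<Longrightarrow> m \<in> set M \<Longrightarrow> a \<lless> m \<or> m \<lless> a" and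
      EM: "\<And>a m. a \<in> set E \<Longrightarrow> m \<in> set M \<Longrightarrow> a \<lless> m \<or> m \<lless> a" and
      AE: "\<And>a e. a \<in> set A \<Longrightarrow> e \<in> set E \<Longrightarrow> a \<lless> e \<or> e \<lless> a"
      using bs unfolding AME(1) blocks_append by auto
    have merged: "a \<lless> concat M \<or> concat M \<lless> a" if a: "a \<in> set A \<union> set E" for a
    proof -
      have cmp: "a \<lless> m \<or> m \<lless> a" if "m \<in> set M" for m using a AM EM that by blast
      have nea: "a \<noteq> []" using a b blocks_nonempty by blast
      have nem: "m \<noteq> []" if "m \<in> set M" for m using that b blocks_nonempty by blast
      have "(\<forall>y\<in>set ms. hd a < y) \<or> (\<forall>y\<in>set ms. y < hd a)"
        using h(3) a unfolding interval_in_def AME(2,4) by auto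
      then have "(\<forall>m\<in>set M. hd a < hd m) \<or> (\<forall>m\<in>set M. hd m < hd a)"
        unfolding AME(3) by auto
      then show ?thesis
      proof
        assume "\<forall>m\<in>set M. hd a < hd m"
        then have "\<forall>m\<in>set M. a \<lless> m" using below_hd[OF cmp nea nem] by blast
        then show ?thesis by (auto simp: below_def)
      next
        assume "\<forall>m\<in>set M. hd m < hd a"
        then have "\<forall>m\<in>set M. m \<lless> a" using below_hd[OF _ nem nea] cmp by blast
        then show ?thesis by (auto simp: below_def)
      qed
    qed
    have "concat M \<noteq> []" using h(2) AME(3) b(2) blocks_nonempty[of M] by (cases M) auto
    then have "blocks (A @ [concat M] @ E)"
      using b merged AE blocks_distinct_concat[OF b(2)] unfolding blocks_append by (auto simp: blocks_Cons)
    moreover have "concat (A @ [concat M] @ E) = xs" using bs AME(1) by simp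
    moreover have "2 \<le> length (A @ [concat M] @ E)" using ne AME(2,4) by (cases A; cases E) auto
    ultimately have "length bs \<le> length (A @ [concat M] @ E)" using min by blast
    then show False using AME(1,3) h(2) by simp
  qed
  then have "simple_list (map hd bs)"
    unfolding simple_list_def using bs \<open>length bs \<noteq> 2\<close> by auto
  with bs show ?thesis by blast
qed

definition canonical_blocks :: "nat list list \<Rightarrow> bool" where
  "canonical_blocks bs \<longleftrightarrow> blocks bs \<and> (simple_list (map hd bs) \<or>
     (\<exists>R\<in>{(<), (>)}. 2 \<le> length bs \<and> sorted_wrt (\<lambda>a b. \<forall>x\<in>set a. \<forall>y\<in>set b. R x y) bs \<and>
        (\<forall>b\<in>set bs. \<not> splittable R b)))"

text \<open>The type of a canonical decomposition can be read off from its concatenation alone.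
  Hence two canonical decompositions of one list have the same type, and uniqueness can be checked
  type by type.\<close>

lemma canonical_blocks_cases:
  assumes "canonical_blocks bs"
  shows "simple_list (map hd bs) \<longleftrightarrow> \<not> splittable (<) (concat bs) \<and> \<not> splittable (>) (concat bs)"
    and "R \<in> {(<), (>)} \<Longrightarrow> splittable R (concat bs) \<longleftrightarrow>
      2 \<le> length bs \<and> sorted_wrt (\<lambda>a b. \<forall>x\<in>set a. \<forall>y\<in>set b. R x y) bs"
    and "R \<in> {(<), (>)} \<Longrightarrow> splittable R (concat bs) \<Longrightarrow> \<forall>b\<in>set bs. \<not> splittable R b"
proof -
  have b: "blocks bs" using assms by (simp add: canonical_blocks_def)
  then have ne: "[] \<notin> set bs" by (auto simp: blocks_def)
  note sp = sorted_blocks_splittable[OF _ ne]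
  have as: "\<not> (splittable (<) (concat bs) \<and> splittable (>) (concat bs))" using splittable_asym by blast
  from assms consider "simple_list (map hd bs)" |
    Q where "Q \<in> {(<), (>)}" "2 \<le> length bs" "sorted_wrt (\<lambda>a b. \<forall>x\<in>set a. \<forall>y\<in>set b. Q x y) bs"
      "\<forall>b\<in>set bs. \<not> splittable Q b"
    unfolding canonical_blocks_def by blast
  then have "(simple_list (map hd bs) \<longleftrightarrow> \<not> splittable (<) (concat bs) \<and> \<not> splittable (>) (concat bs)) \<and>
    (\<forall>R\<in>{(<), (>)}. (splittable R (concat bs) \<longleftrightarrow>
      2 \<le> length bs \<and> sorted_wrt (\<lambda>a b. \<forall>x\<in>set a. \<forall>y\<in>set b. R x y) bs) \<and>
      (splittable R (concat bs) \<longrightarrow> (\<forall>b\<in>set bs. \<not> splittable R b)))"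
  proof cases
    case 1
    note n = simple_blocks_not_splittable[OF b 1]
    then have "\<not> (2 \<le> length bs \<and> sorted_wrt (\<lambda>a b. \<forall>x\<in>set a. \<forall>y\<in>set b. R x y) bs)" if "R \<in> {(<), (>)}" for R
      using that sp[of R] by auto
    with 1 n show ?thesis by simp
  next
    case 2
    have Q: "splittable Q (concat bs)" by (rule sp[OF 2(3,2)])
    then have "\<not> simple_list (map hd bs)" using simple_blocks_not_splittable[OF b] 2(1) by auto
    moreover have eq: "R = Q" if "R \<in> {(<), (>)}" "splittable R (concat bs)" for R
      using that Q as 2(1) by auto
    have "(splittable R (concat bs) \<longleftrightarrow>
      2 \<le> length bs \<and> sorted_wrt (\<lambda>a b. \<forall>x\<in>set a. \<forall>y\<in>set b. R x y) bs) \<and>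
      (splittable R (concat bs) \<longrightarrow> (\<forall>b\<in>set bs. \<not> splittable R b))" if "R \<in> {(<), (>)}" for R
    proof (cases "R = Q")
      case True
      show ?thesis unfolding True using 2(2-4) Q by simp
    next
      case False
      then show ?thesis using eq[OF that] sp[of R] by blast
    qed
    moreover have "splittable (<) (concat bs) \<or> splittable (>) (concat bs)" using Q 2(1) by auto
    ultimately show ?thesis by (intro conjI ballI) blast+
  qed
  note * = this[THEN conjunct1] this[THEN conjunct2, rule_format, of R]
  show "simple_list (map hd bs) \<longleftrightarrow> \<not> splittable (<) (concat bs) \<and> \<not> splittable (>) (concat bs)"
    "R \<in> {(<), (>)} \<Longrightarrow> splittable R (concat bs) \<longleftrightarrow>
      2 \<le> length bs \<and> sorted_wrt (\<lambda>a b. \<forall>x\<in>set a. \<forall>y\<in>set b. R x y) bs"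
    "R \<in> {(<), (>)} \<Longrightarrow> splittable R (concat bs) \<Longrightarrow> \<forall>b\<in>set bs. \<not> splittable R b"
    using * by simp_all
qed

lemma canonical_blocks_unique:
  assumes "canonical_blocks bs" "canonical_blocks cs" "concat bs = concat cs"
  shows "bs = cs"
proof -
  note b = canonical_blocks_cases[OF assms(1)] and c = canonical_blocks_cases[OF assms(2)]
  have bl: "blocks bs" "blocks cs" using assms by (auto simp: canonical_blocks_def)
  consider "simple_list (map hd bs)" | R where "R \<in> {(<), (>)}" "splittable R (concat bs)"
    using b(1) by (meson insertCI)
  then show ?thesis
  proof cases
    case 1
    then show ?thesis using simple_blocks_unique[OF assms(3) bl] b(1) c(1) assms(3) by simp
  next
    case 2
    show ?thesis
      by (rule sorted_blocks_unique[OF assms(3), of R])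
        (use 2 b(2,3)[OF 2(1)] c(2,3)[OF 2(1)] assms(3) bl in \<open>auto dest: blocks_nonempty\<close>)
  qed
qed

lemma canonical_blocks_exist:
  assumes d: "distinct xs" and l: "2 \<le> length xs"
  shows "\<exists>bs. canonical_blocks bs \<and> concat bs = xs"
proof (cases "splittable (<) xs \<or> splittable (>) xs")
  case False
  then show ?thesis using exists_simple_blocks[OF assms] by (auto simp: canonical_blocks_def)
next
  case True
  then obtain R where R: "R \<in> {(<), (>)}" "splittable R xs" by (meson insertCI)
  have "xs \<noteq> []" using l by auto
  from sorted_blocks_exist[OF this, of R] obtain bs where
    bs: "concat bs = xs" "sorted_wrt (\<lambda>a b. \<forall>x\<in>set a. \<forall>y\<in>set b. R x y) bs"
    "\<forall>b\<in>set bs. b \<noteq> [] \<and> \<not> splittable R b" by blast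
  \<comment> \<open>A single block would be \<open>xs\<close> itself, which is splittable.\<close>
  have "2 \<le> length bs"
  proof (rule ccontr)
    assume "\<not> 2 \<le> length bs"
    then have "bs = [] \<or> (\<exists>b. bs = [b])" by (cases bs; cases "tl bs") auto
    then show False using bs R \<open>xs \<noteq> []\<close> by auto
  qed
  moreover have "blocks bs" using sorted_blocks_is_blocks[OF bs(2)] R(1) bs(1,3) d by auto
  ultimately have "canonical_blocks bs"
    unfolding canonical_blocks_def using bs by (intro conjI disjI2 bexI[OF _ R(1)]) auto
  with bs(1) show ?thesis by blast
qed

section \<open>Canonical decompositions\<close>

text \<open>Used only for \<open>R \<in> {(<), (>)}\<close>; the test \<open>R 0 1\<close> tells the two apart.\<close>

definition monotone_perm :: "(nat \<Rightarrow> nat \<Rightarrow> bool) \<Rightarrow> nat \<Rightarrow> perm" where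
  "monotone_perm R d = (if R 0 1 then oplus d else ominus d)"

lemma monotone_perm_simps [simp]:
  "monotone_perm (<) d = oplus d" "monotone_perm (>) d = ominus d"
  by (simp_all add: monotone_perm_def)

lemma is_perm_monotone_perm: "1 \<le> d \<Longrightarrow> is_perm (monotone_perm R d)"
  by (auto simp: monotone_perm_def is_perm_def oplus_def ominus_def)

lemma length_monotone_perm [simp]: "length (monotone_perm R d) = d"
  by (simp add: monotone_perm_def oplus_def ominus_def)

lemma length_oplus [simp]: "length (oplus d) = d"
  by (simp add: oplus_def)

lemma length_ominus [simp]: "length (ominus d) = d"
  by (simp add: ominus_def)

lemma sorted_perm_iff:
  assumes "is_perm \<beta>" "R \<in> {(<), (>)}"
  shows "sorted_wrt R \<beta> \<longleftrightarrow> \<beta> = monotone_perm R (length \<beta>)"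
proof -
  have lt: "sorted_wrt (<) xs \<longleftrightarrow> xs = oplus (length xs)" if "set xs = {1..length xs}" for xs
    using that unfolding oplus_def strict_sorted_iff
    by (metis Suc_eq_plus1 atLeastLessThanSuc_atLeastAtMost distinct_upt set_upt sorted_distinct_set_unique sorted_upt)
  have gt: "sorted_wrt (>) \<beta> \<longleftrightarrow> sorted_wrt (<) (rev \<beta>)"
    by (simp add: sorted_wrt_rev)
  have "sorted_wrt (>) \<beta> \<longleftrightarrow> \<beta> = ominus (length \<beta>)"
    unfolding gt using lt[of "rev \<beta>"] assms(1) by (simp add: is_perm_def ominus_def oplus_def rev_swap)
  with lt[of \<beta>] assms show ?thesis by (auto simp: is_perm_def)
qed

lemma sorted_std_iff:
  assumes "R \<in> {(<), (>)}"
  shows "sorted_wrt R (std xs) \<longleftrightarrow> sorted_wrt R xs"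
  using order_iso_std[of xs] assms by (auto simp: sorted_wrt_iff_nth_less order_iso_def)

lemma std_monotone_iff:
  assumes "distinct xs" "xs \<noteq> []" "R \<in> {(<), (>)}"
  shows "std xs = monotone_perm R (length xs) \<longleftrightarrow> sorted_wrt R xs"
  using sorted_perm_iff[OF is_perm_std[OF assms(2,1)] assms(3)] sorted_std_iff[OF assms(3)] by simp

lemma inflate_obtain_blocks:
  assumes "is_perm \<beta>" "length \<nu>s = length \<beta>" "\<forall>\<mu>\<in>set \<nu>s. is_perm \<mu>"
  obtains bs where "blocks bs" "bs \<noteq> []" "concat bs = inflate \<beta> \<nu>s" "std (map hd bs) = \<beta>" "map std bs = \<nu>s"
    "is_perm (inflate \<beta> \<nu>s)"
proof -
  obtain bs where bs: "blocks bs" "concat bs = inflate \<beta> \<nu>s" "std (map hd bs) = \<beta>" "map std bs = \<nu>s"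
    using inflate_blocks[OF assms] by blast
  have "bs \<noteq> []" using bs(3) assms(1) by (auto simp: is_perm_def)
  then have "concat bs \<noteq> []" using blocks_nonempty[OF bs(1)] by (cases bs) auto
  then have "is_perm (std (concat bs))" using is_perm_std blocks_distinct_concat[OF bs(1)] by blast
  then have "is_perm (inflate \<beta> \<nu>s)" using inflate_std[OF bs(1)] bs by simp
  with bs \<open>bs \<noteq> []\<close> that show thesis by blast
qed

text \<open>Connects indecomposability, which is defined by inflations of 12 and 21, with
  \<open>splittable\<close>: a splitting is a decomposition into two blocks whose quotient is
  monotone.\<close>

lemma inflate_two_iff:
  assumes \<nu>: "is_perm \<nu>" and R: "R \<in> {(<), (>)}"
  shows "(\<exists>\<nu>1 \<nu>2. is_perm \<nu>1 \<and> is_perm \<nu>2 \<and> \<nu> = inflate (monotone_perm R 2) [\<nu>1, \<nu>2]) \<longleftrightarrow> splittable R \<nu>"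
proof
  assume "\<exists>\<nu>1 \<nu>2. is_perm \<nu>1 \<and> is_perm \<nu>2 \<and> \<nu> = inflate (monotone_perm R 2) [\<nu>1, \<nu>2]"
  then obtain \<nu>1 \<nu>2 where *: "is_perm \<nu>1" "is_perm \<nu>2" "\<nu> = inflate (monotone_perm R 2) [\<nu>1, \<nu>2]" by blast
  obtain bs where bs: "blocks bs" "bs \<noteq> []" "concat bs = \<nu>" "std (map hd bs) = monotone_perm R 2" "map std bs = [\<nu>1, \<nu>2]"
    by (rule inflate_obtain_blocks[of "monotone_perm R 2" "[\<nu>1, \<nu>2]"])
      (use * in \<open>auto simp: is_perm_monotone_perm\<close>)
  have l: "length bs = 2" using arg_cong[OF bs(5), of length] by simp
  have "sorted_wrt R (map hd bs)"
    using std_monotone_iff[OF blocks_distinct_hd[OF bs(1)] _ R] bs(2,4) l by simp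
  then have "sorted_wrt (\<lambda>a b. \<forall>x\<in>set a. \<forall>y\<in>set b. R x y) bs"
    using blocks_sorted_iff[OF bs(1), of R] R by simp
  then show "splittable R \<nu>"
    using sorted_blocks_splittable[of R bs] bs(1,3) l by (auto simp: blocks_def)
next
  assume "splittable R \<nu>"
  then obtain ys zs where yz: "\<nu> = ys @ zs" "ys \<noteq> []" "zs \<noteq> []" "\<forall>y\<in>set ys. \<forall>z\<in>set zs. R y z"
    unfolding splittable_def by blast
  have d: "distinct (ys @ zs)" using \<nu> yz by (simp add: is_perm_def)
  have b: "blocks [ys, zs]" using yz R d by (auto simp: blocks_def below_def)
  have "std [hd ys, hd zs] = monotone_perm R 2"
    using std_monotone_iff[OF blocks_distinct_hd[OF b] _ R] yz R by (simp add: numeral_2_eq_2)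
  then have "\<nu> = inflate (monotone_perm R 2) [std ys, std zs]"
    using inflate_std[OF b] yz(1) std_perm[OF \<nu>] by simp
  then show "\<exists>\<nu>1 \<nu>2. is_perm \<nu>1 \<and> is_perm \<nu>2 \<and> \<nu> = inflate (monotone_perm R 2) [\<nu>1, \<nu>2]"
    using is_perm_std yz d by (metis distinct_append)
qed

lemma indecomposable_iff:
  assumes "is_perm \<nu>"
  shows "oplus_indecomposable \<nu> \<longleftrightarrow> \<not> splittable (<) \<nu>" "ominus_indecomposable \<nu> \<longleftrightarrow> \<not> splittable (>) \<nu>"
  using inflate_two_iff[OF assms, of "(<)"] inflate_two_iff[OF assms, of "(>)"]
  unfolding oplus_indecomposable_def ominus_indecomposable_def by simp_all

lemma canonical_decomposition_alt:
  "canonical_decomposition \<nu> \<beta> \<nu>s \<longleftrightarrow> length \<nu>s = length \<beta> \<and> (\<forall>\<mu>\<in>set \<nu>s. is_perm \<mu>) \<and> \<nu> = inflate \<beta> \<nu>s \<and>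
     (simple_perm \<beta> \<or> (\<exists>R\<in>{(<), (>)}. 2 \<le> length \<beta> \<and> \<beta> = monotone_perm R (length \<beta>) \<and>
        (\<forall>\<mu>\<in>set \<nu>s. \<not> splittable R \<mu>)))"
proof (cases "\<forall>\<mu>\<in>set \<nu>s. is_perm \<mu>")
  case True
  then have *: "(\<forall>\<mu>\<in>set \<nu>s. oplus_indecomposable \<mu>) \<longleftrightarrow> (\<forall>\<mu>\<in>set \<nu>s. \<not> splittable (<) \<mu>)"
    "(\<forall>\<mu>\<in>set \<nu>s. ominus_indecomposable \<mu>) \<longleftrightarrow> (\<forall>\<mu>\<in>set \<nu>s. \<not> splittable (>) \<mu>)"
    by (simp_all add: indecomposable_iff)
  have "(\<exists>d\<ge>2. \<beta> = oplus d \<and> P) \<longleftrightarrow> 2 \<le> length \<beta> \<and> \<beta> = oplus (length \<beta>) \<and> P"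
    "(\<exists>d\<ge>2. \<beta> = ominus d \<and> P) \<longleftrightarrow> 2 \<le> length \<beta> \<and> \<beta> = ominus (length \<beta>) \<and> P" for P
    using length_oplus length_ominus by metis+
  then show ?thesis unfolding canonical_decomposition_def * by (simp add: conj_disj_distribL)
next
  case False
  then show ?thesis unfolding canonical_decomposition_def by blast
qed

text \<open>On the right-hand side the quotient and the components are functions of the blocks.
  Existence and uniqueness of \<open>canonical_blocks\<close> thereby become the Albert--Atkinson
  theorem.\<close>

lemma canonical_decomposition_iff_blocks:
  "canonical_decomposition \<nu> \<beta> \<nu>s \<longleftrightarrow>
     is_perm \<nu> \<and> (\<exists>bs. canonical_blocks bs \<and> concat bs = \<nu> \<and> \<beta> = std (map hd bs) \<and> \<nu>s = map std bs)"
proof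
  assume "canonical_decomposition \<nu> \<beta> \<nu>s"
  then have l: "length \<nu>s = length \<beta>" and p: "\<forall>\<mu>\<in>set \<nu>s. is_perm \<mu>" and \<nu>: "\<nu> = inflate \<beta> \<nu>s" and
    c: "simple_perm \<beta> \<or> (\<exists>R\<in>{(<), (>)}. 2 \<le> length \<beta> \<and> \<beta> = monotone_perm R (length \<beta>) \<and>
        (\<forall>\<mu>\<in>set \<nu>s. \<not> splittable R \<mu>))"
    unfolding canonical_decomposition_alt by auto
  have "is_perm \<beta>" using c
  proof
    assume "\<exists>R\<in>{(<), (>)}. 2 \<le> length \<beta> \<and> \<beta> = monotone_perm R (length \<beta>) \<and>
        (\<forall>\<mu>\<in>set \<nu>s. \<not> splittable R \<mu>)"
    then obtain R where "2 \<le> length \<beta>" "\<beta> = monotone_perm R (length \<beta>)" by blast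
    then show ?thesis using is_perm_monotone_perm[of "length \<beta>" R] by simp
  qed (simp add: simple_perm_def)
  from inflate_obtain_blocks[OF this l p]
  obtain bs where bs: "blocks bs" "bs \<noteq> []" "concat bs = \<nu>" "std (map hd bs) = \<beta>" "map std bs = \<nu>s" "is_perm \<nu>"
    using \<nu> by metis
  have d: "distinct (map hd bs)" by (rule blocks_distinct_hd[OF bs(1)])
  have l\<beta>: "length \<beta> = length bs" using bs(4) by auto
  have "canonical_blocks bs" unfolding canonical_blocks_def
  proof (intro conjI)
    show "simple_list (map hd bs) \<or>
     (\<exists>R\<in>{(<), (>)}. 2 \<le> length bs \<and> sorted_wrt (\<lambda>a b. \<forall>x\<in>set a. \<forall>y\<in>set b. R x y) bs \<and>
        (\<forall>b\<in>set bs. \<not> splittable R b))"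
      using c
    proof
      assume "simple_perm \<beta>"
      then show ?thesis using simple_perm_std[OF d] bs(4) by simp
    next
      assume "\<exists>R\<in>{(<), (>)}. 2 \<le> length \<beta> \<and> \<beta> = monotone_perm R (length \<beta>) \<and>
        (\<forall>\<mu>\<in>set \<nu>s. \<not> splittable R \<mu>)"
      then obtain R where R: "R \<in> {(<), (>)}" and *: "2 \<le> length \<beta>" "\<beta> = monotone_perm R (length \<beta>)"
        "\<forall>\<mu>\<in>set \<nu>s. \<not> splittable R \<mu>" by blast
      have "sorted_wrt R (map hd bs)"
        using std_monotone_iff[OF d _ R] bs(2,4) * l\<beta> by simp
      then have "sorted_wrt (\<lambda>a b. \<forall>x\<in>set a. \<forall>y\<in>set b. R x y) bs"
        using blocks_sorted_iff[OF bs(1), of R] R by simp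
      moreover have "\<forall>b\<in>set bs. \<not> splittable R b"
        using *(3) R unfolding bs(5)[symmetric] by (auto simp: splittable_std)
      ultimately show ?thesis using * R l\<beta> by (intro disjI2 bexI[OF _ R]) simp
    qed
  qed (fact bs)
  with bs show "is_perm \<nu> \<and> (\<exists>bs. canonical_blocks bs \<and> concat bs = \<nu> \<and> \<beta> = std (map hd bs) \<and> \<nu>s = map std bs)"
    by blast
next
  assume "is_perm \<nu> \<and> (\<exists>bs. canonical_blocks bs \<and> concat bs = \<nu> \<and> \<beta> = std (map hd bs) \<and> \<nu>s = map std bs)"
  then obtain bs where \<nu>: "is_perm \<nu>" and bs: "canonical_blocks bs" "concat bs = \<nu>" "\<beta> = std (map hd bs)" "\<nu>s = map std bs"
    by blast
  have b: "blocks bs" using bs by (simp add: canonical_blocks_def)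
  have d: "distinct (map hd bs)" by (rule blocks_distinct_hd[OF b])
  have "bs \<noteq> []" using \<nu> bs(2) by (auto simp: is_perm_def)
  have "\<forall>\<mu>\<in>set \<nu>s. is_perm \<mu>" using b unfolding bs(4) by (auto simp: blocks_def intro: is_perm_std)
  moreover have "\<nu> = inflate \<beta> \<nu>s" using inflate_std[OF b] std_perm[OF \<nu>] bs by simp
  moreover have "simple_perm \<beta> \<or> (\<exists>R\<in>{(<), (>)}. 2 \<le> length \<beta> \<and> \<beta> = monotone_perm R (length \<beta>) \<and>
        (\<forall>\<mu>\<in>set \<nu>s. \<not> splittable R \<mu>))"
    using bs(1) unfolding canonical_blocks_def
  proof (elim conjE disjE)
    assume "simple_list (map hd bs)"
    then show ?thesis using simple_perm_std[OF d] bs(3) by simp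
  next
    assume "\<exists>R\<in>{(<), (>)}. 2 \<le> length bs \<and> sorted_wrt (\<lambda>a b. \<forall>x\<in>set a. \<forall>y\<in>set b. R x y) bs \<and>
        (\<forall>b\<in>set bs. \<not> splittable R b)"
    then obtain R where R: "R \<in> {(<), (>)}" and *: "2 \<le> length bs"
      "sorted_wrt (\<lambda>a b. \<forall>x\<in>set a. \<forall>y\<in>set b. R x y) bs" "\<forall>b\<in>set bs. \<not> splittable R b" by blast
    have "sorted_wrt R (map hd bs)" using blocks_sorted_iff[OF b, of R] R *(2) by simp
    then have "\<beta> = monotone_perm R (length \<beta>)"
      using std_monotone_iff[OF d _ R] \<open>bs \<noteq> []\<close> bs(3) by simp
    moreover have "\<forall>\<mu>\<in>set \<nu>s. \<not> splittable R \<mu>"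
      using *(3) R unfolding bs(4) by (auto simp: splittable_std)
    ultimately show ?thesis using *(1) bs(3) by (intro disjI2 bexI[OF _ R]) simp
  qed
  ultimately show "canonical_decomposition \<nu> \<beta> \<nu>s"
    unfolding canonical_decomposition_alt using bs by simp
qed

lemma canonical_decomposition_unique:
  assumes "canonical_decomposition \<nu> \<beta> \<nu>s" "canonical_decomposition \<nu> \<beta>' \<nu>s'"
  shows "\<beta> = \<beta>' \<and> \<nu>s = \<nu>s'"
  using assms unfolding canonical_decomposition_iff_blocks by (auto dest: canonical_blocks_unique)

lemma canonical_decomposition_exists:
  assumes "is_perm \<nu>" "2 \<le> length \<nu>"
  shows "\<exists>\<beta> \<nu>s. canonical_decomposition \<nu> \<beta> \<nu>s"
proof -
  have "distinct \<nu>" using assms(1) by (simp add: is_perm_def)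
  then show ?thesis
    using canonical_blocks_exist[OF _ assms(2)] assms(1) unfolding canonical_decomposition_iff_blocks by blast
qed

text \<open>The kind of root decoration depends only on the splittings that \<nu> admits. This later
  turns indecomposability of the components into a condition on the roots of the subtrees.\<close>

lemma canonical_decomposition_type:
  assumes "canonical_decomposition \<nu> \<beta> \<nu>s"
  shows "is_perm \<nu>" "is_perm \<beta>"
    and "simple_perm \<beta> \<longleftrightarrow> oplus_indecomposable \<nu> \<and> ominus_indecomposable \<nu>"
    and "(\<exists>k\<ge>2. \<beta> = oplus k) \<longleftrightarrow> \<not> oplus_indecomposable \<nu>"
    and "(\<exists>k\<ge>2. \<beta> = ominus k) \<longleftrightarrow> \<not> ominus_indecomposable \<nu>"
proof -
  obtain bs where bs: "is_perm \<nu>" "canonical_blocks bs" "concat bs = \<nu>" "\<beta> = std (map hd bs)"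
    using assms unfolding canonical_decomposition_iff_blocks by blast
  note c = canonical_blocks_cases[OF bs(2), unfolded bs(3)]
  have b: "blocks bs" using bs by (simp add: canonical_blocks_def)
  have d: "distinct (map hd bs)" by (rule blocks_distinct_hd[OF b])
  have ne: "bs \<noteq> []" using bs(1,3) by (auto simp: is_perm_def)
  show "is_perm \<nu>" by fact
  show "is_perm \<beta>" unfolding bs(4) by (rule is_perm_std[OF _ d]) (simp add: ne)
  show "simple_perm \<beta> \<longleftrightarrow> oplus_indecomposable \<nu> \<and> ominus_indecomposable \<nu>"
    using c(1) simple_perm_std[OF d] bs(4) indecomposable_iff[OF bs(1)] by simp
  have *: "(2 \<le> length \<beta> \<and> \<beta> = monotone_perm R (length \<beta>)) \<longleftrightarrow> splittable R \<nu>" if R: "R \<in> {(<), (>)}" for R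
    using c(2)[OF R] blocks_sorted_iff[OF b, of R] std_monotone_iff[OF d _ R] R ne bs(4) by simp
  have "(\<exists>k\<ge>2. \<beta> = oplus k) \<longleftrightarrow> 2 \<le> length \<beta> \<and> \<beta> = oplus (length \<beta>)"
    "(\<exists>k\<ge>2. \<beta> = ominus k) \<longleftrightarrow> 2 \<le> length \<beta> \<and> \<beta> = ominus (length \<beta>)"
    using length_oplus length_ominus by metis+
  then show "(\<exists>k\<ge>2. \<beta> = oplus k) \<longleftrightarrow> \<not> oplus_indecomposable \<nu>"
    "(\<exists>k\<ge>2. \<beta> = ominus k) \<longleftrightarrow> \<not> ominus_indecomposable \<nu>"
    using *[of "(<)"] *[of "(>)"] indecomposable_iff[OF bs(1)] by simp_all
qed

lemma canonical_decomposition_length: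
  assumes "canonical_decomposition \<nu> \<beta> \<nu>s"
  shows "2 \<le> length \<nu>" "\<mu> \<in> set \<nu>s \<Longrightarrow> is_perm \<mu> \<and> length \<mu> < length \<nu>"
proof -
  obtain bs where bs: "is_perm \<nu>" "canonical_blocks bs" "concat bs = \<nu>" "\<nu>s = map std bs"
    using assms unfolding canonical_decomposition_iff_blocks by blast
  have b: "blocks bs" using bs by (simp add: canonical_blocks_def)
  have l2: "2 \<le> length bs" using bs(2) unfolding canonical_blocks_def simple_list_def by auto
  have lt: "length c < length \<nu>" if c: "c \<in> set bs" for c
  proof -
    obtain A B where AB: "bs = A @ c # B" using split_list[OF c] by blast
    then have "A \<noteq> [] \<or> B \<noteq> []" using l2 by auto
    then have "concat A @ concat B \<noteq> []" using blocks_nonempty[OF b] AB by (auto simp: neq_Nil_conv)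
    then show ?thesis unfolding bs(3)[symmetric] AB by (auto simp: neq_Nil_conv)
  qed
  \<comment> \<open>A block is nonempty and shorter than \<nu>, which forces \<nu> to have at least
    two entries.\<close>
  have "hd bs \<in> set bs" using l2 by (cases bs) auto
  from lt[OF this] blocks_nonempty[OF b this] show "2 \<le> length \<nu>" by (cases "hd bs") auto
  show "is_perm \<mu> \<and> length \<mu> < length \<nu>" if "\<mu> \<in> set \<nu>s"
    using that lt assms unfolding bs(4) canonical_decomposition_def by auto
qed

section \<open>Parts of a decomposition as patterns\<close>

lemma subseq_concat: "b \<in> set bs \<Longrightarrow> subseq b (concat bs)"
proof (induction bs)
  case (Cons a bs)
  then show ?case
    using subseq_drop_many[of b "concat bs" a] subseq_rev_drop_many[of a a "concat bs"] by auto
qed simp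

lemma subseq_hd_concat: "[] \<notin> set bs \<Longrightarrow> subseq (map hd bs) (concat bs)"
proof (induction bs)
  case (Cons a bs)
  then have "subseq ([hd a] @ map hd bs) (a @ concat bs)"
    by (intro list_emb_append_mono) (auto simp: subseq_singleton_left)
  then show ?case by simp
qed simp

text \<open>The heads of the blocks form a subsequence order isomorphic to the quotient, and each
  block is a subsequence order isomorphic to its component. A permutation class therefore contains
  every part of the decomposition of each of its members.\<close>

lemma canonical_decomposition_patterns:
  assumes "canonical_decomposition \<nu> \<beta> \<nu>s"
  shows "is_pattern_of \<beta> \<nu>" "\<mu> \<in> set \<nu>s \<Longrightarrow> is_pattern_of \<mu> \<nu>"
proof -
  obtain bs where bs: "is_perm \<nu>" "canonical_blocks bs" "concat bs = \<nu>" "\<beta> = std (map hd bs)" "\<nu>s = map std bs"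
    using assms unfolding canonical_decomposition_iff_blocks by blast
  have "[] \<notin> set bs" using bs(2) by (auto simp: canonical_blocks_def blocks_def)
  then show "is_pattern_of \<beta> \<nu>"
    unfolding is_pattern_of_def using canonical_decomposition_type(2)[OF assms]
      subseq_hd_concat[of bs] order_iso_std[of "map hd bs"] bs(3,4) by blast
  assume \<mu>: "\<mu> \<in> set \<nu>s"
  then obtain b where "b \<in> set bs" "\<mu> = std b" using bs(5) by auto
  then show "is_pattern_of \<mu> \<nu>"
    unfolding is_pattern_of_def using canonical_decomposition_length(2)[OF assms \<mu>]
      subseq_concat[of b bs] order_iso_std[of b] bs(3) by blast
qed

section \<open>Decomposition into \<oplus>-indecomposable summands\<close>

lemma inflate_singleton: "inflate (oplus 1) [\<nu>] = \<nu>"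
  by (simp add: inflate_def oplus_def cong: conj_cong)

text \<open>Merges the two alternatives in the definition of \<open>oplus_components\<close>:
  inflating \<open>oplus 1\<close> changes nothing, so a list of length 1 covers the
  \<oplus>-indecomposable case.\<close>

definition oplus_sum_of :: "perm list \<Rightarrow> perm \<Rightarrow> bool" where
  "oplus_sum_of \<nu>s \<nu> \<longleftrightarrow> \<nu>s \<noteq> [] \<and> (\<forall>\<mu>\<in>set \<nu>s. is_perm \<mu> \<and> oplus_indecomposable \<mu>) \<and>
     \<nu> = inflate (oplus (length \<nu>s)) \<nu>s"

lemma oplus_sum_of_iff_blocks:
  "oplus_sum_of \<nu>s \<nu> \<longleftrightarrow> is_perm \<nu> \<and> (\<exists>bs. concat bs = \<nu> \<and> sorted_wrt (\<lambda>a b. \<forall>x\<in>set a. \<forall>y\<in>set b. x < y) bs \<and>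
     (\<forall>b\<in>set bs. b \<noteq> [] \<and> \<not> splittable (<) b) \<and> \<nu>s = map std bs)"
proof
  assume s: "oplus_sum_of \<nu>s \<nu>"
  then have l: "1 \<le> length \<nu>s" by (cases \<nu>s) (auto simp: oplus_sum_of_def)
  obtain bs where bs: "blocks bs" "bs \<noteq> []" "concat bs = \<nu>" "std (map hd bs) = oplus (length \<nu>s)" "map std bs = \<nu>s"
    "is_perm \<nu>"
    using inflate_obtain_blocks[of "monotone_perm (<) (length \<nu>s)" \<nu>s] is_perm_monotone_perm[OF l, of "(<)"] s
    unfolding oplus_sum_of_def by (metis length_oplus monotone_perm_simps(1))
  have "length bs = length \<nu>s" using bs(5) by auto
  then have "sorted_wrt (<) (map hd bs)"
    using std_monotone_iff[OF blocks_distinct_hd[OF bs(1)], of "(<)"] bs(2,4) by simp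
  then have "sorted_wrt (\<lambda>a b. \<forall>x\<in>set a. \<forall>y\<in>set b. x < y) bs"
    using blocks_sorted_iff[OF bs(1), of "(<)"] by simp
  moreover have "\<forall>b\<in>set bs. b \<noteq> [] \<and> \<not> splittable (<) b"
    using s blocks_nonempty[OF bs(1)] unfolding oplus_sum_of_def bs(5)[symmetric]
    by (auto simp: indecomposable_iff splittable_std)
  ultimately show "is_perm \<nu> \<and> (\<exists>bs. concat bs = \<nu> \<and> sorted_wrt (\<lambda>a b. \<forall>x\<in>set a. \<forall>y\<in>set b. x < y) bs \<and>
     (\<forall>b\<in>set bs. b \<noteq> [] \<and> \<not> splittable (<) b) \<and> \<nu>s = map std bs)"
    using bs by blast
next
  assume "is_perm \<nu> \<and> (\<exists>bs. concat bs = \<nu> \<and> sorted_wrt (\<lambda>a b. \<forall>x\<in>set a. \<forall>y\<in>set b. x < y) bs \<and>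
     (\<forall>b\<in>set bs. b \<noteq> [] \<and> \<not> splittable (<) b) \<and> \<nu>s = map std bs)"
  then obtain bs where \<nu>: "is_perm \<nu>" and bs: "concat bs = \<nu>" "sorted_wrt (\<lambda>a b. \<forall>x\<in>set a. \<forall>y\<in>set b. x < y) bs"
    "\<forall>b\<in>set bs. b \<noteq> [] \<and> \<not> splittable (<) b" "\<nu>s = map std bs" by blast
  have b: "blocks bs" using sorted_blocks_is_blocks[OF bs(2)] bs(1,3) \<nu> by (auto simp: is_perm_def)
  have ne: "bs \<noteq> []" using \<nu> bs(1) by (auto simp: is_perm_def)
  have "sorted_wrt (<) (map hd bs)" using blocks_sorted_iff[OF b, of "(<)"] bs(2) by simp
  then have "std (map hd bs) = oplus (length bs)"
    using std_monotone_iff[OF blocks_distinct_hd[OF b], of "(<)"] ne by simp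
  then have "\<nu> = inflate (oplus (length bs)) (map std bs)"
    using inflate_std[OF b] std_perm[OF \<nu>] bs(1) by simp
  moreover have "is_perm (std b) \<and> oplus_indecomposable (std b)" if "b \<in> set bs" for b
  proof -
    have "is_perm (std b)" using is_perm_std b that by (auto simp: blocks_def)
    then show ?thesis using bs(3) that by (simp add: indecomposable_iff splittable_std)
  qed
  ultimately show "oplus_sum_of \<nu>s \<nu>" using ne bs(4) by (auto simp: oplus_sum_of_def)
qed

lemma oplus_sum_of_unique: "oplus_sum_of \<nu>s \<nu> \<Longrightarrow> oplus_sum_of \<nu>s' \<nu> \<Longrightarrow> \<nu>s = \<nu>s'"
  unfolding oplus_sum_of_iff_blocks by (auto dest: sorted_blocks_unique[of _ _ "(<)"])

lemma oplus_sum_of_exists: "is_perm \<nu> \<Longrightarrow> \<exists>\<nu>s. oplus_sum_of \<nu>s \<nu>"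
  unfolding oplus_sum_of_iff_blocks using sorted_blocks_exist[of \<nu> "(<)"] by (auto simp: is_perm_def)

lemma oplus_components_sum_of:
  assumes "is_perm \<nu>"
  shows "oplus_sum_of (oplus_components \<nu>) \<nu>"
proof -
  have "((oplus_indecomposable \<nu> \<and> \<nu>s = [\<nu>])
     \<or> (\<exists>d\<ge>2. length \<nu>s = d \<and> (\<forall>\<mu>\<in>set \<nu>s. is_perm \<mu> \<and> oplus_indecomposable \<mu>) \<and>
          \<nu> = inflate (oplus d) \<nu>s)) \<longleftrightarrow> oplus_sum_of \<nu>s \<nu>" for \<nu>s
  proof (cases "2 \<le> length \<nu>s")
    case True
    then show ?thesis unfolding oplus_sum_of_def by auto
  next
    case False
    then have "\<nu>s = [] \<or> (\<exists>\<mu>. \<nu>s = [\<mu>])" by (cases \<nu>s; cases "tl \<nu>s") auto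
    then show ?thesis
    proof
      assume "\<exists>\<mu>. \<nu>s = [\<mu>]"
      then show ?thesis using assms inflate_singleton by (auto simp: oplus_sum_of_def)
    qed (auto simp: oplus_sum_of_def)
  qed
  then have "oplus_components \<nu> = (THE \<nu>s. oplus_sum_of \<nu>s \<nu>)"
    unfolding oplus_components_def by simp
  moreover obtain \<nu>s where "oplus_sum_of \<nu>s \<nu>" using oplus_sum_of_exists[OF assms] by blast
  ultimately show ?thesis using oplus_sum_of_unique by (metis theI)
qed

section \<open>Canonical trees as inverses of iterated inflation\<close>

lemma blocks_singletons: "distinct xs \<Longrightarrow> blocks (map (\<lambda>x. [x]) xs)"
  by (auto simp: blocks_def sorted_wrt_map sorted_wrt_iff_nth_less below_def distinct_conv_nth neq_iff)

text \<open>A permutation is its own list of heads under the decomposition into singleton blocks, so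
  the result for simple quotients applies.\<close>

lemma simple_perm_not_splittable:
  assumes "simple_perm \<sigma>"
  shows "\<not> splittable (<) \<sigma>" "\<not> splittable (>) \<sigma>"
proof -
  have "is_perm \<sigma>" "simple_list \<sigma>" using assms simple_perm_iff_simple_list by (auto simp: simple_perm_def)
  then show "\<not> splittable (<) \<sigma>" "\<not> splittable (>) \<sigma>"
    using simple_blocks_not_splittable[OF blocks_singletons[of \<sigma>]] by (auto simp: is_perm_def comp_def)
qed

lemma splittable_monotone_perm:
  assumes "2 \<le> k"
  shows "splittable (<) (oplus k)" "splittable (>) (ominus k)"
proof -
  have p: "is_perm (oplus k)" "is_perm (ominus k)"
    using is_perm_monotone_perm[of k "(<)"] is_perm_monotone_perm[of k "(>)"] assms by auto
  have s: "splittable R xs" if sorted: "sorted_wrt R xs" "length xs = k" for R xs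
  proof -
    obtain x y ys where "xs = x # y # ys" using sorted(2) assms by (metis Suc_le_length_iff numeral_2_eq_2)
    with sorted show ?thesis unfolding splittable_def by (intro exI[of _ "[x]"] exI[of _ "y # ys"]) auto
  qed
  have "sorted_wrt (<) (oplus k)" "sorted_wrt (>) (ominus k)"
    using sorted_perm_iff[OF p(1), of "(<)"] sorted_perm_iff[OF p(2), of "(>)"] by simp_all
  then show "splittable (<) (oplus k)" "splittable (>) (ominus k)"
    by (simp_all add: s)
qed

text \<open>The two signs can be told apart only from size 2 on: \<open>oplus 1\<close> and
  \<open>ominus 1\<close> coincide.\<close>

lemma oplus_neq_ominus:
  assumes "2 \<le> k"
  shows "oplus k \<noteq> ominus l"
proof
  assume eq: "oplus k = ominus l"
  then have "k = l" using length_oplus length_ominus by metis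
  then show False using splittable_monotone_perm[OF assms] eq splittable_asym by simp
qed

lemma not_simple_monotone_perm: "2 \<le> k \<Longrightarrow> \<not> simple_perm (oplus k)" "2 \<le> k \<Longrightarrow> \<not> simple_perm (ominus k)"
  using splittable_monotone_perm simple_perm_not_splittable by blast+

fun perm_of :: "perm ptree \<Rightarrow> perm" where
  "perm_of Leaf = [1]"
| "perm_of (Node \<beta> ts) = inflate \<beta> (map perm_of ts)"

fun ominus_rooted :: "perm ptree \<Rightarrow> bool" where
  "ominus_rooted Leaf \<longleftrightarrow> False"
| "ominus_rooted (Node \<beta> ts) \<longleftrightarrow> (\<exists>k\<ge>2. \<beta> = ominus k)"

lemma length_inflate:
  assumes "is_perm \<beta>" "length \<nu>s = length \<beta>" "\<forall>\<mu>\<in>set \<nu>s. is_perm \<mu>"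
  shows "length (inflate \<beta> \<nu>s) = sum_list (map length \<nu>s)"
proof -
  obtain bs where bs: "concat bs = inflate \<beta> \<nu>s" "map std bs = \<nu>s"
    using inflate_blocks[OF assms] by blast
  have "sum_list (map length \<nu>s) = length (concat bs)"
    unfolding bs(2)[symmetric] by (simp add: length_concat comp_def)
  then show ?thesis using bs(1) by simp
qed

text \<open>Iterated inflation undoes the canonical tree, which makes \<open>CT\<close> injective;
  the leaf count is carried along for size preservation.\<close>

lemma canonical_tree_perm_of:
  assumes "canonical_tree \<nu> T"
  shows "is_perm \<nu> \<and> perm_of T = \<nu> \<and> leaves T = length \<nu>"
  using assms
proof (induction rule: canonical_tree.induct)
  case (Leaf \<nu>)
  then obtain x where "\<nu> = [x]" by (metis One_nat_def length_0_conv length_Suc_conv)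
  with Leaf show ?case by (simp add: is_perm_def)
next
  case (Node \<nu> \<beta> \<nu>s ts)
  have "length \<nu>s = length ts"
    and nth: "\<And>i. i < length ts \<Longrightarrow> perm_of (ts ! i) = \<nu>s ! i \<and> leaves (ts ! i) = length (\<nu>s ! i)"
    using Node.IH by (simp_all add: list_all2_conv_all_nth)
  then have p: "map perm_of ts = \<nu>s" "map leaves ts = map length \<nu>s"
    by (simp_all add: list_eq_iff_nth_eq)
  then show ?case
    using canonical_decomposition_type(1,2)[OF Node.hyps] Node.hyps length_inflate[of \<beta> \<nu>s]
    by (simp add: canonical_decomposition_def)
qed

lemma canonical_tree_exists: "is_perm \<nu> \<Longrightarrow> \<exists>T. canonical_tree \<nu> T"
proof (induction \<nu> rule: length_induct)
  case (1 \<nu>)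
  show ?case
  proof (cases "2 \<le> length \<nu>")
    case True
    then obtain \<beta> \<nu>s where d: "canonical_decomposition \<nu> \<beta> \<nu>s"
      using canonical_decomposition_exists "1.prems" by blast
    then have "\<forall>\<mu>\<in>set \<nu>s. \<exists>T. canonical_tree \<mu> T"
      using "1.IH" canonical_decomposition_length(2) by blast
    then obtain f where "\<forall>\<mu>\<in>set \<nu>s. canonical_tree \<mu> (f \<mu>)" by metis
    then have "list_all2 canonical_tree \<nu>s (map f \<nu>s)"
      by (simp add: list_all2_conv_all_nth)
    with d show ?thesis using canonical_tree.Node by blast
  next
    case False
    moreover have "length \<nu> \<noteq> 0" using "1.prems" by (simp add: is_perm_def)
    ultimately have "length \<nu> = 1" by linarith
    then show ?thesis using canonical_tree.Leaf "1.prems" by blast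
  qed
qed

lemma canonical_tree_unique:
  assumes "canonical_tree \<nu> T" "canonical_tree \<nu> T'"
  shows "T = T'"
  using assms
proof (induction arbitrary: T' rule: canonical_tree.induct)
  case (Leaf \<nu>)
  from Leaf(3) show ?case
    by cases (use Leaf(2) canonical_decomposition_length(1) in fastforce)+
next
  case (Node \<nu> \<beta> \<nu>s ts)
  from Node.prems show ?case
  proof cases
    case Leaf
    then show ?thesis using Node.hyps canonical_decomposition_length(1) by fastforce
  next
    case (Node \<beta>' \<nu>s' ts')
    then have "\<beta>' = \<beta>" "\<nu>s' = \<nu>s" using canonical_decomposition_unique Node.hyps by blast+
    moreover from this have "ts = ts'"
      using Node.IH Node(3) by (auto simp: list_all2_conv_all_nth intro!: nth_equalityI)
    ultimately show ?thesis using Node(1) by simp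
  qed
qed

lemma canonical_tree_CT: "is_perm \<nu> \<Longrightarrow> canonical_tree \<nu> (CT \<nu>)"
  unfolding CT_def using canonical_tree_exists canonical_tree_unique by (metis theI)

section \<open>Canonical trees of a class, described by local conditions\<close>

lemma canonical_tree_rooted:
  assumes "canonical_tree \<nu> T"
  shows "oplus_rooted T \<longleftrightarrow> \<not> oplus_indecomposable \<nu>" "ominus_rooted T \<longleftrightarrow> \<not> ominus_indecomposable \<nu>"
proof -
  have "(oplus_rooted T \<longleftrightarrow> \<not> oplus_indecomposable \<nu>) \<and> (ominus_rooted T \<longleftrightarrow> \<not> ominus_indecomposable \<nu>)"
    using assms
  proof cases
    case Leaf
    have "\<not> splittable R \<nu>" for R
    proof
      assume "splittable R \<nu>"
      then obtain ys zs where "\<nu> = ys @ zs" "ys \<noteq> []" "zs \<noteq> []" unfolding splittable_def by blast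
      then have "2 \<le> length \<nu>" by (cases ys; cases zs) auto
      with Leaf show False by simp
    qed
    with Leaf show ?thesis by (simp add: indecomposable_iff)
  next
    case (Node \<beta> \<nu>s ts)
    then show ?thesis using canonical_decomposition_type(4,5) by simp
  qed
  then show "oplus_rooted T \<longleftrightarrow> \<not> oplus_indecomposable \<nu>" "ominus_rooted T \<longleftrightarrow> \<not> ominus_indecomposable \<nu>"
    by blast+
qed

text \<open>Describes canonical trees without reference to the permutations of their subtrees. By
  \<open>canonical_tree_rooted\<close>, indecomposability of a component means that its subtree does
  not carry the sign at its root, so for simple \<open>S\<close> the condition is that no sign
  repeats along an edge. Packing can then be studied on trees alone.\<close>

fun canonical :: "perm set \<Rightarrow> perm ptree \<Rightarrow> bool" where
  "canonical S Leaf \<longleftrightarrow> True"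
| "canonical S (Node \<beta> ts) \<longleftrightarrow> length ts = length \<beta> \<and> (\<forall>t\<in>set ts. canonical S t) \<and>
     (\<beta> \<in> S \<or> (\<exists>k\<ge>2. \<beta> = oplus k) \<and> (\<forall>t\<in>set ts. \<not> oplus_rooted t)
       \<or> (\<exists>k\<ge>2. \<beta> = ominus k) \<and> (\<forall>t\<in>set ts. \<not> ominus_rooted t))"

lemma canonical_treeD:
  assumes "permutation_class C" "canonical_tree \<nu> T" "\<nu> \<in> C"
  shows "canonical {\<sigma> \<in> C. simple_perm \<sigma>} T"
  using assms(2,3)
proof (induction rule: canonical_tree.induct)
  case (Node \<nu> \<beta> \<nu>s ts)
  have C: "\<beta> \<in> C" "\<And>\<mu>. \<mu> \<in> set \<nu>s \<Longrightarrow> \<mu> \<in> C"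
    using assms(1) canonical_decomposition_patterns[OF Node.hyps] Node.prems
    unfolding permutation_class_def by blast+
  have l: "length ts = length \<nu>s" using Node.IH by (auto dest: list_all2_lengthD)
  have ts: "\<exists>\<mu>\<in>set \<nu>s. canonical_tree \<mu> t \<and> canonical {\<sigma> \<in> C. simple_perm \<sigma>} t" if "t \<in> set ts" for t
  proof -
    obtain i where i: "i < length ts" "t = ts ! i" using \<open>t \<in> set ts\<close> by (auto simp: in_set_conv_nth)
    then have "\<nu>s ! i \<in> set \<nu>s" using l by simp
    then show ?thesis using list_all2_nthD2[OF Node.IH i(1)] i(2) C(2) by blast
  qed
  have rooted: "\<not> oplus_rooted t" if "t \<in> set ts" "\<forall>\<mu>\<in>set \<nu>s. oplus_indecomposable \<mu>" for t
    using ts[OF that(1)] that(2) canonical_tree_rooted(1) by blast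
  have rooted': "\<not> ominus_rooted t" if "t \<in> set ts" "\<forall>\<mu>\<in>set \<nu>s. ominus_indecomposable \<mu>" for t
    using ts[OF that(1)] that(2) canonical_tree_rooted(2) by blast
  have "simple_perm \<beta> \<or> (\<exists>k\<ge>2. \<beta> = oplus k) \<and> (\<forall>t\<in>set ts. \<not> oplus_rooted t)
       \<or> (\<exists>k\<ge>2. \<beta> = ominus k) \<and> (\<forall>t\<in>set ts. \<not> ominus_rooted t)"
    using Node.hyps rooted rooted' unfolding canonical_decomposition_def by blast
  with ts l C(1) Node.hyps show ?case by (auto simp: canonical_decomposition_def)
qed simp

lemma inflate_two:
  "inflate [1, 2] [\<mu>, \<nu>] = \<mu> @ map (\<lambda>x. x + length \<mu>) \<nu>"
  "inflate [2, 1] [\<mu>, \<nu>] = map (\<lambda>x. x + length \<nu>) \<mu> @ \<nu>"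
proof -
  have "{j. j < Suc (Suc 0) \<and> [Suc 0, 2] ! j = 0} = {}" "{j. j < Suc (Suc 0) \<and> [Suc 0, 2] ! j < 2} = {0}"
    "{j. j < Suc (Suc 0) \<and> [2, Suc 0] ! j = 0} = {}" "{j. j < Suc (Suc 0) \<and> [2, Suc 0] ! j < 2} = {1}"
    by (auto simp: less_Suc_eq intro!: gr0I)
  then show "inflate [1, 2] [\<mu>, \<nu>] = \<mu> @ map (\<lambda>x. x + length \<mu>) \<nu>"
    "inflate [2, 1] [\<mu>, \<nu>] = map (\<lambda>x. x + length \<nu>) \<mu> @ \<nu>"
    by (simp_all add: inflate_def del: Collect_empty_eq)
qed

text \<open>The permutation of size 1 is a pattern of 12. From there \<open>oplus (Suc k)\<close> is
  12 inflated by \<open>oplus k\<close> and a point, and \<open>ominus (Suc k)\<close> is 21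
  inflated by a point and \<open>ominus k\<close>.\<close>

lemma monotone_perms_in_class:
  assumes "permutation_class C" "substitution_closed C" "[1, 2] \<in> C" "[2, 1] \<in> C" "1 \<le> k"
  shows "oplus k \<in> C" "ominus k \<in> C"
proof -
  have one: "[1] \<in> C"
  proof -
    have "is_pattern_of [1] [1, 2]"
      unfolding is_pattern_of_def by (auto simp: is_perm_def order_iso_def intro!: exI[of _ "[1]"])
    then show ?thesis using assms(1,3) unfolding permutation_class_def by blast
  qed
  have sub: "inflate \<theta> [\<mu>, \<nu>] \<in> C" if "\<theta> \<in> C" "length \<theta> = 2" "\<mu> \<in> C" "\<nu> \<in> C" for \<theta> \<mu> \<nu>
    using assms(2) that unfolding substitution_closed_def by simp
  have "oplus k \<in> C \<and> ominus k \<in> C" using assms(5)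
  proof (induction k rule: dec_induct)
    case base
    then show ?case using one by (simp add: oplus_def ominus_def)
  next
    case (step k)
    have "inflate [1, 2] [oplus k, [1]] = oplus (Suc k)" "inflate [2, 1] [[1], ominus k] = ominus (Suc k)"
      unfolding inflate_two by (simp_all add: oplus_def ominus_def)
    then show ?case using sub[OF assms(3), of "oplus k" "[1]"] sub[OF assms(4), of "[1]" "ominus k"] one step by simp
  qed
  then show "oplus k \<in> C" "ominus k \<in> C" by auto
qed

text \<open>Surjectivity of \<open>CT\<close>. Closure under substitution gives membership in the
  class; the sign condition is translated back into indecomposability of the components, whose
  canonical trees are the subtrees by induction.\<close>

lemma canonical_perm_of:
  assumes "permutation_class C" "substitution_closed C" "[1, 2] \<in> C" "[2, 1] \<in> C"
    and "canonical {\<sigma> \<in> C. simple_perm \<sigma>} T"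
  shows "perm_of T \<in> C \<and> canonical_tree (perm_of T) T"
  using assms(5)
proof (induction T)
  case Leaf
  have "is_perm [1]" by (simp add: is_perm_def)
  then show ?case using monotone_perms_in_class(1)[OF assms(1-4), of 1] canonical_tree.Leaf
    by (simp add: oplus_def)
next
  case (Node \<beta> ts)
  have ts: "perm_of t \<in> C \<and> canonical_tree (perm_of t) t" if "t \<in> set ts" for t
    using Node that by simp
  have p: "is_perm \<nu>" if "\<nu> \<in> C" for \<nu> using that assms(1) by (simp add: permutation_class_def)
  have \<beta>: "\<beta> \<in> C" using Node.prems monotone_perms_in_class[OF assms(1-4)] by auto
  have "canonical_decomposition (perm_of (Node \<beta> ts)) \<beta> (map perm_of ts)"
    unfolding canonical_decomposition_def
  proof (intro conjI)
    have *: "oplus_indecomposable (perm_of t) \<longleftrightarrow> \<not> oplus_rooted t"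
      "ominus_indecomposable (perm_of t) \<longleftrightarrow> \<not> ominus_rooted t" if "t \<in> set ts" for t
      using canonical_tree_rooted ts[OF that] by blast+
    then have "(\<forall>\<mu>\<in>set (map perm_of ts). oplus_indecomposable \<mu>) \<longleftrightarrow> (\<forall>t\<in>set ts. \<not> oplus_rooted t)"
      "(\<forall>\<mu>\<in>set (map perm_of ts). ominus_indecomposable \<mu>) \<longleftrightarrow> (\<forall>t\<in>set ts. \<not> ominus_rooted t)" by simp_all
    then show "simple_perm \<beta>
      \<or> (\<exists>d\<ge>2. \<beta> = oplus d \<and> (\<forall>\<mu>\<in>set (map perm_of ts). oplus_indecomposable \<mu>))
      \<or> (\<exists>d\<ge>2. \<beta> = ominus d \<and> (\<forall>\<mu>\<in>set (map perm_of ts). ominus_indecomposable \<mu>))"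
      using Node.prems by auto
  qed (use Node.prems ts p in auto)
  moreover have "list_all2 canonical_tree (map perm_of ts) ts"
    using ts by (simp add: list_all2_conv_all_nth)
  moreover have "perm_of (Node \<beta> ts) \<in> C"
  proof -
    have "set (map perm_of ts) \<subseteq> C" "length (map perm_of ts) = length \<beta>" using ts Node.prems by auto
    then show ?thesis using assms(2) \<beta> unfolding substitution_closed_def perm_of.simps by blast
  qed
  ultimately show ?case using canonical_tree.Node by blast
qed

lemma bij_betw_CT:
  assumes "permutation_class C" "substitution_closed C" "[1, 2] \<in> C" "[2, 1] \<in> C"
  shows "bij_betw CT {\<nu> \<in> C. oplus_indecomposable \<nu>} {T. canonical {\<sigma> \<in> C. simple_perm \<sigma>} T \<and> \<not> oplus_rooted T}"
proof (rule bij_betw_byWitness[where f' = perm_of])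
  have CT: "canonical_tree \<nu> (CT \<nu>)" if "\<nu> \<in> C" for \<nu>
    using that assms(1) canonical_tree_CT by (simp add: permutation_class_def)
  note T = canonical_perm_of[OF assms]
  show "\<forall>\<nu>\<in>{\<nu> \<in> C. oplus_indecomposable \<nu>}. perm_of (CT \<nu>) = \<nu>"
    using CT canonical_tree_perm_of by blast
  show "\<forall>T\<in>{T. canonical {\<sigma> \<in> C. simple_perm \<sigma>} T \<and> \<not> oplus_rooted T}. CT (perm_of T) = T"
    using T CT canonical_tree_unique by blast
  show "CT ` {\<nu> \<in> C. oplus_indecomposable \<nu>} \<subseteq> {T. canonical {\<sigma> \<in> C. simple_perm \<sigma>} T \<and> \<not> oplus_rooted T}"
    using CT canonical_treeD[OF assms(1)] canonical_tree_rooted(1) by blast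
  show "perm_of ` {T. canonical {\<sigma> \<in> C. simple_perm \<sigma>} T \<and> \<not> oplus_rooted T} \<subseteq> {\<nu> \<in> C. oplus_indecomposable \<nu>}"
    using T canonical_tree_rooted(1) by blast
qed

section \<open>Packing\<close>

text \<open>\<open>gadget_part t\<close> tells how many of the listed subtrees belong to
  \<open>t\<close>: one if it is a leaf, otherwise the outdegree of the \<oplus>-vertex. So a
  concatenation of such lists can be parsed from the left.\<close>

lemma attached_gadget_part_inj:
  assumes "gadget_part t = gadget_part t'" "attached t @ us = attached t' @ us'"
  shows "t = t' \<and> us = us'"
  using assms
proof -
  have *: "attached t = [t]" if "gadget_part t = Leaf" for t
    using that by (cases t) (auto split: if_splits)
  show ?thesis
  proof (cases "gadget_part t")
    case Leaf
    then show ?thesis using *[of t] *[of t'] assms by simp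
  next
    case (Node \<beta> gs)
    then show ?thesis using assms by (cases t; cases t') (auto split: if_splits dest: map_eq_imp_length_eq)
  qed
qed

lemma attached_gadget_parts_inj:
  assumes "map gadget_part ts = map gadget_part ts'" "concat (map attached ts) = concat (map attached ts')"
  shows "ts = ts'"
  using assms
proof (induction ts arbitrary: ts')
  case (Cons t ts)
  then obtain t' us where ts': "ts' = t' # us" by (cases ts') auto
  with Cons.prems have "gadget_part t = gadget_part t'"
    "attached t @ concat (map attached ts) = attached t' @ concat (map attached us)" by auto
  from attached_gadget_part_inj[OF this] show ?case using Cons.IH[of us] Cons.prems(1) ts' by simp
qed simp

text \<open>Injectivity is asked only for pairs drawn from the two lists, which is what an induction
  hypothesis on subtrees can provide.\<close>

lemma map_eq_pointwise:
  assumes "map f xs = map f ys" "\<And>x y. x \<in> set xs \<Longrightarrow> y \<in> set ys \<Longrightarrow> f x = f y \<Longrightarrow> x = y"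
  shows "xs = ys"
  using assms by (simp add: list_eq_iff_nth_eq)

text \<open>Summed over the children of a simple vertex, this is the size condition on the vertex
  decorated by its gadget.\<close>

lemma length_attached: "length (attached t) = leaves (gadget_part t)"
  by (cases t) (auto simp: comp_def sum_list_triv)

lemma leaves_attached: "sum_list (map leaves (attached t)) = leaves t"
  by (cases t) auto

lemma leaves_PA: "leaves (PA T) = leaves T"
proof (induction T rule: PA.induct)
  case (2 \<beta> ts)
  show ?case
  proof (cases "simple_perm \<beta>")
    case True
    have "map (leaves \<circ> PA) (concat (map attached ts)) = map leaves (concat (map attached ts))"
      using "2.IH"(1)[OF True] by simp
    then have "sum_list (map (leaves \<circ> PA) (concat (map attached ts))) = sum_list (map leaves (concat (map attached ts)))"
      by (rule arg_cong)
    moreover have "sum_list (map leaves (concat (map attached ts))) = sum_list (map leaves ts)"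
      by (induction ts) (simp_all add: leaves_attached)
    ultimately show ?thesis using True by simp
  next
    case False
    then have "map (leaves \<circ> PA) ts = map leaves ts" using "2.IH"(2) by simp
    then have "sum_list (map (leaves \<circ> PA) ts) = sum_list (map leaves ts)" by (rule arg_cong)
    with False show ?thesis by simp
  qed
qed simp

context
  fixes S :: "perm set"
  assumes S: "\<And>\<sigma>. \<sigma> \<in> S \<Longrightarrow> simple_perm \<sigma>"
begin

text \<open>If \<open>t\<close> is \<oplus>-rooted, its children are not, because no sign repeats
  along an edge; otherwise \<open>t\<close> is attached as it stands.\<close>

lemma attached_canonical:
  assumes "canonical S t" "u \<in> set (attached t)"
  shows "canonical S u \<and> \<not> oplus_rooted u"
proof (cases t)
  case (Node \<beta> ts)
  show ?thesis
  proof (cases "oplus_rooted t")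
    case True
    then obtain k where k: "2 \<le> k" "\<beta> = oplus k" using Node by auto
    \<comment> \<open>With \<beta> neither simple nor decreasing, only the \<oplus>-clause of
      \<open>canonical\<close> is left.\<close>
    have "\<beta> \<notin> S" using S not_simple_monotone_perm(1)[OF k(1)] k(2) by blast
    moreover have "\<not> (\<exists>l\<ge>2. \<beta> = ominus l)" using oplus_neq_ominus[OF k(1)] k(2) by simp
    ultimately show ?thesis using assms Node True by auto
  next
    case False
    then have "attached t = [t]" unfolding Node by (simp del: oplus_rooted.simps)
    with assms False show ?thesis by simp
  qed
qed (use assms in auto)

text \<open>\<open>PA\<close> confuses \<open>\<oplus>\<close> with \<open>\<ominus>\<close> at the root, and excluding the same one of the two for both trees
  is a condition that passes to the children.\<close>

lemma PA_inj:
  assumes "canonical S T" "canonical S T'" "PA T = PA T'"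
    and "\<not> oplus_rooted T \<and> \<not> oplus_rooted T' \<or> \<not> ominus_rooted T \<and> \<not> ominus_rooted T'"
  shows "T = T'"
  using assms
\<comment> \<open>The size is used because subtrees attached to a gadget may be grandchildren of the
  root.\<close>
proof (induction "size T" arbitrary: T T' rule: less_induct)
  case less
  show ?case
  proof (cases T)
    case Leaf
    then show ?thesis using less.prems(3) by (cases T') (auto split: if_splits)
  next
    case (Node \<beta> ts)
    then obtain \<beta>' ts' where Node': "T' = Node \<beta>' ts'"
      using less.prems(3) by (cases T') (auto split: if_splits)
    have can: "canonical S t" if "t \<in> set ts \<union> set ts'" for t
      using that less.prems(1,2) Node Node' by auto
    show ?thesis
    proof (cases "simple_perm \<beta>")
      case True
      then have eq: "\<beta>' = \<beta>" "map gadget_part ts = map gadget_part ts'"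
        "map PA (concat (map attached ts)) = map PA (concat (map attached ts'))"
        using less.prems(3) Node Node' by (simp_all split: if_splits)
      have "u = u'" if u: "u \<in> set (concat (map attached ts))" and u': "u' \<in> set (concat (map attached ts'))"
        and "PA u = PA u'" for u u'
      proof (rule less.hyps)
        obtain t where t: "t \<in> set ts" "u \<in> set (attached t)" using u by auto
        then show "size u < size T" using size_attached_list Node by auto
        obtain t' where t': "t' \<in> set ts'" "u' \<in> set (attached t')" using u' by auto
        have *: "canonical S u \<and> \<not> oplus_rooted u" "canonical S u' \<and> \<not> oplus_rooted u'"
          using attached_canonical t t' can by blast+
        then show "canonical S u" "canonical S u'"
          "\<not> oplus_rooted u \<and> \<not> oplus_rooted u' \<or> \<not> ominus_rooted u \<and> \<not> ominus_rooted u'" by blast+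
      qed fact
      from map_eq_pointwise[OF eq(3) this] have "concat (map attached ts) = concat (map attached ts')" .
      then show ?thesis using attached_gadget_parts_inj eq Node Node' by blast
    next
      case False
      then have eq: "\<not> simple_perm \<beta>'" "length \<beta>' = length \<beta>" "map PA ts = map PA ts'"
        using less.prems(3) Node Node' by (simp_all split: if_splits)
      have "(\<exists>k\<ge>2. \<beta> = oplus k) \<or> (\<exists>k\<ge>2. \<beta> = ominus k)" "(\<exists>k\<ge>2. \<beta>' = oplus k) \<or> (\<exists>k\<ge>2. \<beta>' = ominus k)"
        using False eq(1) S less.prems(1,2) Node Node' by auto
      \<comment> \<open>Both roots carry a sign, and excluding one sign for both leaves the same
        sign; equal outdegrees then give equal decorations.\<close>
      then have same: "\<beta> = oplus (length \<beta>) \<and> \<beta>' = oplus (length \<beta>) \<or> \<beta> = ominus (length \<beta>) \<and> \<beta>' = ominus (length \<beta>)"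
        and l: "2 \<le> length \<beta>"
        using less.prems(4) Node Node' eq(2) by auto
      have "\<beta> \<notin> S" "\<beta>' \<notin> S" using False eq(1) S by blast+
      have \<beta>: "\<beta>' = \<beta>" using same by auto
      \<comment> \<open>The children of both trees avoid the sign of the roots, so the excluded sign
        switches when passing from the roots to their children.\<close>
      have kids: "(\<forall>t\<in>set ts \<union> set ts'. \<not> oplus_rooted t) \<or> (\<forall>t\<in>set ts \<union> set ts'. \<not> ominus_rooted t)"
      proof (cases "\<beta> = oplus (length \<beta>)")
        case True
        then have "\<not> (\<exists>k\<ge>2. \<beta> = ominus k)" using oplus_neq_ominus[OF l] by metis
        then show ?thesis using less.prems(1,2) Node Node' \<open>\<beta> \<notin> S\<close> \<beta> by auto
      next
        case False
        then have "\<not> (\<exists>k\<ge>2. \<beta> = oplus k)" by auto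
        then show ?thesis using less.prems(1,2) Node Node' \<open>\<beta> \<notin> S\<close> \<beta> by auto
      qed
      have "t = t'" if t: "t \<in> set ts" and t': "t' \<in> set ts'" and "PA t = PA t'" for t t'
      proof (rule less.hyps)
        show "size t < size T" using size_less_size_list[OF t] Node by simp
        show "canonical S t" "canonical S t'" using can t t' by auto
        show "\<not> oplus_rooted t \<and> \<not> oplus_rooted t' \<or> \<not> ominus_rooted t \<and> \<not> ominus_rooted t'"
          using kids t t' by auto
      qed fact
      from map_eq_pointwise[OF eq(3) this] have "ts = ts'" .
      then show ?thesis unfolding Node Node' \<beta> by simp
    qed
  qed
qed

lemma PA_packed: "canonical S T \<Longrightarrow> PA T \<in> packed_trees S"
proof (induction T rule: PA.induct)
  case (2 \<beta> ts)
  have ts: "canonical S t" if "t \<in> set ts" for t using that "2.prems" by simp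
  show ?case
  proof (cases "simple_perm \<beta>")
    case True
    then have "\<beta> \<in> S" "length ts = length \<beta>" using "2.prems" not_simple_monotone_perm by auto
    have "is_perm \<beta>" using True by (simp add: simple_perm_def)
    have part: "gadget_part t = Leaf \<or> (\<exists>k\<ge>2. gadget_part t = Node (oplus k) (replicate k Leaf))" if "t \<in> set ts" for t
      using ts[OF that] by (cases t) (auto simp: map_replicate_const oplus_neq_ominus)
    let ?g = "Node \<beta> (map gadget_part ts)"
    have "is_gadget S ?g"
    proof -
      have h: "height (gadget_part t) \<le> 1" if "t \<in> set ts" for t
        using part[OF that] by (auto simp: image_constant_conv)
      have d: "decorated_tree {\<nu>. is_perm \<nu>} length (gadget_part t)" if "t \<in> set ts" for t
        using part[OF that] is_perm_monotone_perm[of _ "(<)"] by auto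
      have "height ?g \<le> 2" using h by auto
      moreover have "decorated_tree {\<nu>. is_perm \<nu>} length ?g"
        using d \<open>is_perm \<beta>\<close> \<open>length ts = length \<beta>\<close> by simp
      moreover have "\<forall>g\<in>set (map gadget_part ts). g = Leaf \<or> (\<exists>k us. k \<ge> 2 \<and> g = Node (oplus k) us)"
        using part by fastforce
      ultimately show ?thesis using \<open>\<beta> \<in> S\<close> unfolding is_gadget_def by blast
    qed
    moreover have "leaves ?g = length (concat (map attached ts))"
      by (simp add: length_concat length_attached comp_def)
    moreover have "decorated_tree (packed_decorations S) decoration_size (PA u)"
      if "u \<in> set (concat (map attached ts))" for u
      using "2.IH"(1)[OF True that] that attached_canonical ts by (auto simp: packed_trees_def)
    ultimately show ?thesis using True by (auto simp: packed_trees_def packed_decorations_def)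
  next
    case False
    then have "2 \<le> length \<beta>" "length ts = length \<beta>" using "2.prems" S by auto
    moreover have "decorated_tree (packed_decorations S) decoration_size (PA t)" if "t \<in> set ts" for t
      using "2.IH"(2)[OF False that] ts[OF that] by (simp add: packed_trees_def)
    ultimately show ?thesis using False by (auto simp: packed_trees_def packed_decorations_def)
  qed
qed (simp add: packed_trees_def)

text \<open>\<open>us\<close> is cut along the leaf counts of \<open>gs\<close>. A leaf takes one
  tree, which stays outside the gadget because it is not \<oplus>-rooted; an \<oplus>-vertex takes
  its \<open>k\<close> trees as children, which \<open>canonical\<close> permits for the same
  reason.\<close>

lemma exists_gadget_preimage:
  assumes "\<forall>g\<in>set gs. g = Leaf \<or> (\<exists>k\<ge>2. g = Node (oplus k) (replicate k Leaf))"
    and "length us = sum_list (map leaves gs)"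
    and "\<forall>u\<in>set us. canonical S u \<and> \<not> oplus_rooted u"
  shows "\<exists>ts. map gadget_part ts = gs \<and> concat (map attached ts) = us \<and> (\<forall>t\<in>set ts. canonical S t)"
  using assms
proof (induction gs arbitrary: us)
  case (Cons g gs)
  define vs ws where "vs = take (leaves g) us" and "ws = drop (leaves g) us"
  have us: "us = vs @ ws" and len: "length vs = leaves g" "length ws = sum_list (map leaves gs)"
    using Cons.prems(2) by (auto simp: vs_def ws_def)
  have "\<exists>t. gadget_part t = g \<and> attached t = vs \<and> canonical S t"
  proof -
    consider "g = Leaf" | k where "2 \<le> k" "g = Node (oplus k) (replicate k Leaf)" using Cons.prems(1) by auto
    then show ?thesis
    proof cases
      case 1
      then obtain v where v: "vs = [v]" using len(1) by (auto simp: length_Suc_conv)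
      then have "canonical S v" "\<not> oplus_rooted v" using Cons.prems(3) us by auto
      then show ?thesis using v 1 by (intro exI[of _ v]) (cases v; auto)
    next
      case 2
      then have "length vs = k" using len(1) by (simp add: sum_list_replicate)
      then show ?thesis using 2 Cons.prems(3) us
        by (intro exI[of _ "Node (oplus k) vs"]) (auto simp: map_replicate_const)
    qed
  qed
  moreover have "\<exists>ts. map gadget_part ts = gs \<and> concat (map attached ts) = ws \<and> (\<forall>t\<in>set ts. canonical S t)"
    using Cons.IH[OF _ len(2)] Cons.prems us by auto
  ultimately obtain t ts where "gadget_part t = g \<and> attached t = vs \<and> canonical S t"
    "map gadget_part ts = gs \<and> concat (map attached ts) = ws \<and> (\<forall>t\<in>set ts. canonical S t)" by blast
  then show ?case using us by (intro exI[of _ "t # ts"]) auto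
qed simp

text \<open>The height bound makes the children of every \<oplus>-vertex below the root leaves, so
  such a vertex is determined by its outdegree.\<close>

lemma is_gadgetD:
  assumes "is_gadget S g"
  obtains \<alpha> gs where "g = Node \<alpha> gs" "\<alpha> \<in> S" "length gs = length \<alpha>"
    "\<forall>t\<in>set gs. t = Leaf \<or> (\<exists>k\<ge>2. t = Node (oplus k) (replicate k Leaf))"
proof -
  obtain \<alpha> gs where g: "g = Node \<alpha> gs" "\<alpha> \<in> S"
    "\<forall>t\<in>set gs. t = Leaf \<or> (\<exists>k us. k \<ge> 2 \<and> t = Node (oplus k) us)"
    and h: "height g \<le> 2" and d: "decorated_tree {\<nu>. is_perm \<nu>} length g"
    using assms unfolding is_gadget_def by blast
  have "t = Leaf \<or> (\<exists>k\<ge>2. t = Node (oplus k) (replicate k Leaf))" if t: "t \<in> set gs" for t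
  proof (cases "t = Leaf")
    case False
    then obtain k us where k: "2 \<le> k" "t = Node (oplus k) us" using g(3) t by blast
    have "height t \<le> 1" using h t g(1) by simp
    then have h0: "height u = 0" if "u \<in> set us" for u
      using Max_ge[of "insert 0 (height ` set us)" "height u"] that k(2) by simp
    have "u = Leaf" if "u \<in> set us" for u using h0[OF that] by (cases u) auto
    moreover have "length us = k" using d g(1) t k(2) by auto
    ultimately have "us = replicate k Leaf" by (metis replicate_eqI)
    with k show ?thesis by blast
  qed simp
  moreover have "length gs = length \<alpha>" using d g(1) by simp
  ultimately show thesis using that g(1,2) by blast
qed

text \<open>The induction needs both preimages: a \<circledast> can be read as \<oplus> over
  children avoiding \<oplus>, or as \<ominus> over children avoiding \<ominus>. At a gadget one tree
  serves both purposes, as its root is simple; below it only preimages avoiding \<oplus> are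
  used.\<close>

lemma PA_surj:
  assumes "P \<in> packed_trees S"
  shows "(\<exists>T. canonical S T \<and> \<not> oplus_rooted T \<and> PA T = P) \<and> (\<exists>T. canonical S T \<and> \<not> ominus_rooted T \<and> PA T = P)"
  using assms
proof (induction P)
  case Leaf
  have "canonical S Leaf" "\<not> oplus_rooted Leaf" "\<not> ominus_rooted Leaf" "PA Leaf = Leaf" by simp_all
  then show ?case by blast
next
  case (Node d us)
  then have d: "d \<in> packed_decorations S" "length us = decoration_size d" by (auto simp: packed_trees_def)
  have IH: "(\<exists>T. canonical S T \<and> \<not> oplus_rooted T \<and> PA T = u) \<and> (\<exists>T. canonical S T \<and> \<not> ominus_rooted T \<and> PA T = u)"
    if "u \<in> set us" for u
    using Node that by (simp add: packed_trees_def)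
  obtain f where f: "\<And>u. u \<in> set us \<Longrightarrow> canonical S (f u) \<and> \<not> oplus_rooted (f u) \<and> PA (f u) = u"
    using IH by metis
  obtain f' where f': "\<And>u. u \<in> set us \<Longrightarrow> canonical S (f' u) \<and> \<not> ominus_rooted (f' u) \<and> PA (f' u) = u"
    using IH by metis
  show ?case
  proof (cases d)
    case (Gadget g)
    then have "is_gadget S g" using d(1) by (simp add: packed_decorations_def)
    from is_gadgetD[OF this] obtain \<alpha> gs where g: "g = Node \<alpha> gs" "\<alpha> \<in> S" "length gs = length \<alpha>"
      "\<forall>t\<in>set gs. t = Leaf \<or> (\<exists>k\<ge>2. t = Node (oplus k) (replicate k Leaf))" by blast
    have "length (map f us) = sum_list (map leaves gs)" using d(2) Gadget g(1) by simp
    from exists_gadget_preimage[OF g(4) this] f obtain ts where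
      ts: "map gadget_part ts = gs" "concat (map attached ts) = map f us" "\<forall>t\<in>set ts. canonical S t" by auto
    have s: "simple_perm \<alpha>" using S g(2) .
    have "length ts = length \<alpha>" using ts(1) g(3) by auto
    then have "canonical S (Node \<alpha> ts)" using ts(3) g(2) by simp
    moreover have "\<not> oplus_rooted (Node \<alpha> ts)" "\<not> ominus_rooted (Node \<alpha> ts)"
      using s not_simple_monotone_perm by auto
    moreover have "PA (Node \<alpha> ts) = Node d us"
      using s ts(1,2) g(1) Gadget f by (simp add: map_idI)
    ultimately show ?thesis by blast
  next
    case (Star k)
    then have k: "2 \<le> k" "length us = k" using d by (auto simp: packed_decorations_def)
    have "canonical S (Node (oplus k) (map f us))" "\<not> ominus_rooted (Node (oplus k) (map f us))"
      "PA (Node (oplus k) (map f us)) = Node d us"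
      using k f Star oplus_neq_ominus not_simple_monotone_perm by (auto simp: map_idI)
    moreover have "canonical S (Node (ominus k) (map f' us))" "\<not> oplus_rooted (Node (ominus k) (map f' us))"
      "PA (Node (ominus k) (map f' us)) = Node d us"
      using k f' Star not_simple_monotone_perm by (auto simp: map_idI oplus_neq_ominus[symmetric])
    ultimately show ?thesis by blast
  qed
qed

lemma bij_betw_PA: "bij_betw PA {T. canonical S T \<and> \<not> oplus_rooted T} (packed_trees S)"
  unfolding bij_betw_def
proof
  show "inj_on PA {T. canonical S T \<and> \<not> oplus_rooted T}"
    by (rule inj_onI) (use PA_inj in blast)
  show "PA ` {T. canonical S T \<and> \<not> oplus_rooted T} = packed_trees S"
  proof
    show "packed_trees S \<subseteq> PA ` {T. canonical S T \<and> \<not> oplus_rooted T}"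
      using PA_surj by blast
  qed (use PA_packed in blast)
qed

end

section \<open>Sums within the class and the assembly of \<open>DF\<close>\<close>

lemma oplus_sum_of_pattern:
  assumes "oplus_sum_of \<nu>s \<nu>" "\<mu> \<in> set \<nu>s"
  shows "is_pattern_of \<mu> \<nu>"
proof -
  obtain bs where "concat bs = \<nu>" "\<nu>s = map std bs" using assms(1) unfolding oplus_sum_of_iff_blocks by blast
  moreover from this obtain b where "b \<in> set bs" "\<mu> = std b" using assms(2) by auto
  moreover have "is_perm \<mu>" using assms by (simp add: oplus_sum_of_def)
  ultimately show ?thesis
    unfolding is_pattern_of_def using subseq_concat[of b bs] order_iso_std[of b] by blast
qed

text \<open>Summands stay in the class as patterns, and sums stay in it as inflations of
  \<open>oplus\<close>; uniqueness of the summands makes the two maps mutually inverse.\<close>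

lemma bij_betw_oplus_components:
  assumes "permutation_class C" "substitution_closed C" "[1, 2] \<in> C" "[2, 1] \<in> C"
  shows "bij_betw oplus_components C (Seq1 {\<nu> \<in> C. oplus_indecomposable \<nu>})"
proof (rule bij_betw_byWitness[where f' = "\<lambda>\<nu>s. inflate (oplus (length \<nu>s)) \<nu>s"])
  have p: "is_perm \<nu>" if "\<nu> \<in> C" for \<nu> using that assms(1) by (simp add: permutation_class_def)
  have sum: "oplus_sum_of (oplus_components \<nu>) \<nu>" if "\<nu> \<in> C" for \<nu>
    using oplus_components_sum_of p that by blast
  show "\<forall>\<nu>\<in>C. inflate (oplus (length (oplus_components \<nu>))) (oplus_components \<nu>) = \<nu>"
    using sum by (simp add: oplus_sum_of_def)
  show "oplus_components ` C \<subseteq> Seq1 {\<nu> \<in> C. oplus_indecomposable \<nu>}"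
  proof
    fix \<nu>s assume "\<nu>s \<in> oplus_components ` C"
    then obtain \<nu> where \<nu>: "\<nu> \<in> C" "oplus_sum_of \<nu>s \<nu>" using sum by blast
    then have "\<mu> \<in> C" if "\<mu> \<in> set \<nu>s" for \<mu>
      using oplus_sum_of_pattern[OF \<nu>(2) that] assms(1) unfolding permutation_class_def by blast
    with \<nu>(2) show "\<nu>s \<in> Seq1 {\<nu> \<in> C. oplus_indecomposable \<nu>}"
      by (auto simp: Seq1_def oplus_sum_of_def)
  qed
  have inv: "inflate (oplus (length \<nu>s)) \<nu>s \<in> C \<and> oplus_sum_of \<nu>s (inflate (oplus (length \<nu>s)) \<nu>s)"
    if "\<nu>s \<in> Seq1 {\<nu> \<in> C. oplus_indecomposable \<nu>}" for \<nu>s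
  proof
    have \<nu>s: "\<nu>s \<noteq> []" "set \<nu>s \<subseteq> C" "\<forall>\<mu>\<in>set \<nu>s. oplus_indecomposable \<mu>" using that by (auto simp: Seq1_def)
    then have "1 \<le> length \<nu>s" by (simp add: Suc_le_eq)
    then have "oplus (length \<nu>s) \<in> C" using monotone_perms_in_class[OF assms] by blast
    then show "inflate (oplus (length \<nu>s)) \<nu>s \<in> C"
      using assms(2) \<nu>s(2) unfolding substitution_closed_def by simp
    show "oplus_sum_of \<nu>s (inflate (oplus (length \<nu>s)) \<nu>s)"
      using \<nu>s p by (auto simp: oplus_sum_of_def)
  qed
  show "\<forall>\<nu>s\<in>Seq1 {\<nu> \<in> C. oplus_indecomposable \<nu>}. oplus_components (inflate (oplus (length \<nu>s)) \<nu>s) = \<nu>s"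
    using inv sum oplus_sum_of_unique by blast
  show "(\<lambda>\<nu>s. inflate (oplus (length \<nu>s)) \<nu>s) ` Seq1 {\<nu> \<in> C. oplus_indecomposable \<nu>} \<subseteq> C"
    using inv by blast
qed

lemma bij_betw_map_Seq1: "bij_betw f A B \<Longrightarrow> bij_betw (map f) (Seq1 A) (Seq1 B)"
proof -
  assume f: "bij_betw f A B"
  have "Seq1 A = lists A - {[]}" "Seq1 B = lists B - {[]}" by (auto simp: Seq1_def lists_eq_set)
  moreover have "bij_betw (map f) (lists A - {[]}) (lists B - {[]})"
    using bij_betw_DiffI[OF bij_lists[OF f], of "{[]}" "{[]}"] by (auto simp: bij_betw_def)
  ultimately show ?thesis by simp
qed

theorem theorem2p19:
  fixes C S :: "perm set" and P :: "decoration ptree set"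
  assumes "permutation_class C"
    and "substitution_closed C"
    and "[1, 2] \<in> C" and "[2, 1] \<in> C"
    and "S = {\<sigma> \<in> C. simple_perm \<sigma>}"
    and "P = packed_trees S"
  shows "bij_betw DF C (Seq1 P) \<and> (\<forall>\<nu>\<in>C. forest_size (DF \<nu>) = length \<nu>)"
proof
  have "bij_betw PA {T. canonical S T \<and> \<not> oplus_rooted T} P"
    unfolding assms(6) by (rule bij_betw_PA) (simp add: assms(5))
  with bij_betw_CT[OF assms(1-4)] have "bij_betw (PA \<circ> CT) {\<nu> \<in> C. oplus_indecomposable \<nu>} P"
    unfolding assms(5) by (rule bij_betw_trans)
  \<comment> \<open>\<open>DF\<close> splits a permutation into its summands and then applies
    \<open>PA \<circ> CT\<close> to each entry of the list.\<close>
  from bij_betw_trans[OF bij_betw_oplus_components[OF assms(1-4)] bij_betw_map_Seq1[OF this]]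
  show "bij_betw DF C (Seq1 P)"
    by (simp add: DF_def[abs_def] comp_def)
  show "\<forall>\<nu>\<in>C. forest_size (DF \<nu>) = length \<nu>"
  proof
    fix \<nu> assume "\<nu> \<in> C"
    then have "is_perm \<nu>" using assms(1) by (simp add: permutation_class_def)
    then have s: "oplus_sum_of (oplus_components \<nu>) \<nu>" by (rule oplus_components_sum_of)
    then have p: "\<forall>\<mu>\<in>set (oplus_components \<nu>). is_perm \<mu>" by (simp add: oplus_sum_of_def)
    have "leaves (PA (CT \<mu>)) = length \<mu>" if "\<mu> \<in> set (oplus_components \<nu>)" for \<mu>
      using canonical_tree_perm_of[OF canonical_tree_CT] p that by (simp add: leaves_PA)
    then have "forest_size (DF \<nu>) = sum_list (map length (oplus_components \<nu>))"
      by (simp add: forest_size_def DF_def comp_def cong: map_cong)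
    also obtain bs where "concat bs = \<nu>" "oplus_components \<nu> = map std bs"
      using s unfolding oplus_sum_of_iff_blocks by blast
    \<comment> \<open>Standardising keeps lengths, so the sizes of the summands add up to the length
      of the concatenated blocks.\<close>
    then have "sum_list (map length (oplus_components \<nu>)) = length \<nu>"
      by (auto simp: length_concat comp_def)
    finally show "forest_size (DF \<nu>) = length \<nu>" .
  qed
qed

end
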